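(* Let $G$ and $H$ be cubic graphs on $n_G$ and $n_H$ vertices, respectively. Then $$\chi''_=(G \circ H) = \Delta(G\circ H) + 1 = n_H + 4.$$
   Context: All graphs are finite, simple, undirected. The corona $G\circ H$ is obtained by taking one copy of $G$ and $n_G=|V(G)|$ copies $H_1,\dots,H_{n_G}$ of $H$, and joining the $i$-th vertex of $G$ to every vertex of $H_i$. A $k$-total-coloring of a graph assigns one of $k$ colors to each vertex and each edge so that adjacent vertices, adjacent edges (sharing an endpoint), and a vertex and any edge incident to it all receive different colors. It is equitable if the sizes of any two color classes (counting both vertices and edges) differ by at most one. $\chi''_=(X)$ is the least $k$ such that $X$ has an equitable $k$-total-coloring, and $\Delta(X)$ is the maximum degree of $X$. *)

theory Defs
  imports Main
begin

text \<open>A graph is a pair of a vertex set and a set of edges, an edge being the two-element set of its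
  endpoints. As usual, the vertex set of a graph is not empty.\<close>

type_synonym 'a ugraph = "'a set \<times> 'a set set"

abbreviation verts :: "'a ugraph \<Rightarrow> 'a set" where
  "verts G \<equiv> fst G"

abbreviation edges :: "'a ugraph \<Rightarrow> 'a set set" where
  "edges G \<equiv> snd G"

definition simple_graph :: "'a ugraph \<Rightarrow> bool" where
  "simple_graph G \<longleftrightarrow> finite (verts G) \<and> verts G \<noteq> {} \<and>
     (\<forall>e \<in> edges G. e \<subseteq> verts G \<and> card e = 2)"

definition degree :: "'a ugraph \<Rightarrow> 'a \<Rightarrow> nat" where
  "degree G v = card {e \<in> edges G. v \<in> e}"

definition max_degree :: "'a ugraph \<Rightarrow> nat" where
  "max_degree G = Max (degree G ` verts G)"

definition cubic_graph :: "'a ugraph \<Rightarrow> bool" where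
  "cubic_graph G \<longleftrightarrow> simple_graph G \<and> (\<forall>v \<in> verts G. degree G v = 3)"

text \<open>The copies of \<open>H\<close> are indexed by the vertices of \<open>G\<close>: the vertex \<open>x\<close> of the copy belonging to
  \<open>v\<close> is \<open>Inr (v, x)\<close>.\<close>

definition corona :: "'a ugraph \<Rightarrow> 'b ugraph \<Rightarrow> ('a + 'a \<times> 'b) ugraph" where
  "corona G H =
     (Inl ` verts G \<union> Inr ` (verts G \<times> verts H),
      {Inl ` e | e. e \<in> edges G} \<union>
      {(\<lambda>x. Inr (v, x)) ` e | v e. v \<in> verts G \<and> e \<in> edges H} \<union>
      {{Inl v, Inr (v, x)} | v x. v \<in> verts G \<and> x \<in> verts H})"

text \<open>A total coloring colors the disjoint union \<open>verts G <+> edges G\<close>; the \<open>k\<close> colors are the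
  numbers below \<open>k\<close>.\<close>

definition total_coloring :: "'a ugraph \<Rightarrow> nat \<Rightarrow> ('a + 'a set \<Rightarrow> nat) \<Rightarrow> bool" where
  "total_coloring G k c \<longleftrightarrow>
     (\<forall>x \<in> verts G <+> edges G. c x < k) \<and>
     (\<forall>u \<in> verts G. \<forall>v \<in> verts G. {u, v} \<in> edges G \<longrightarrow> c (Inl u) \<noteq> c (Inl v)) \<and>
     (\<forall>e \<in> edges G. \<forall>f \<in> edges G. e \<noteq> f \<and> e \<inter> f \<noteq> {} \<longrightarrow> c (Inr e) \<noteq> c (Inr f)) \<and>
     (\<forall>v \<in> verts G. \<forall>e \<in> edges G. v \<in> e \<longrightarrow> c (Inl v) \<noteq> c (Inr e))"

definition color_class :: "'a ugraph \<Rightarrow> ('a + 'a set \<Rightarrow> nat) \<Rightarrow> nat \<Rightarrow> ('a + 'a set) set" where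
  "color_class G c i = {x \<in> verts G <+> edges G. c x = i}"

text \<open>All \<open>k\<close> classes are compared, including those of colors that are not used.\<close>

definition equitable_total_coloring :: "'a ugraph \<Rightarrow> nat \<Rightarrow> ('a + 'a set \<Rightarrow> nat) \<Rightarrow> bool" where
  "equitable_total_coloring G k c \<longleftrightarrow> total_coloring G k c \<and>
     (\<forall>i < k. \<forall>j < k. card (color_class G c i) \<le> card (color_class G c j) + 1)"

definition equitable_total_chromatic_number :: "'a ugraph \<Rightarrow> nat" where
  "equitable_total_chromatic_number G = (LEAST k. \<exists>c. equitable_total_coloring G k c)"

text \<open>The minimum is attained: coloring all elements differently is equitable.\<close>

lemma equitable_total_coloring_exists:
  assumes "simple_graph G"
  shows "\<exists>k c. equitable_total_coloring G k c"
proof -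
  have "edges G \<subseteq> Pow (verts G)" and "finite (verts G)"
    using assms by (auto simp: simple_graph_def)
  then have "finite (verts G <+> edges G)"
    by (meson finite_Plus finite_Pow_iff finite_subset)
  then obtain c :: "'a + 'a set \<Rightarrow> nat" and k
    where im: "c ` (verts G <+> edges G) = {i. i < k}" and inj: "inj_on c (verts G <+> edges G)"
    using finite_imp_inj_to_nat_seg by metis
  have eq: "c x = c y \<longleftrightarrow> x = y"
    if "x \<in> verts G <+> edges G" "y \<in> verts G <+> edges G" for x y
    using inj that by (rule inj_on_eq_iff)
  have "u \<noteq> v" if "{u, v} \<in> edges G" for u v
    using that assms by (fastforce simp: simple_graph_def)
  then have "total_coloring G k c"
    unfolding total_coloring_def using im by (auto simp: eq InlI InrI)
  moreover have "card (color_class G c i) \<le> 1" for i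
  proof -
    have "x = y" if "x \<in> color_class G c i" "y \<in> color_class G c i" for x y
      using that eq[of x y] unfolding color_class_def by simp
    then show ?thesis
      by (metis One_nat_def card.infinite card_le_Suc0_iff_eq zero_le)
  qed
  then have "card (color_class G c i) \<le> card (color_class G c j) + 1" for i j
    by (rule trans_le_add2)
  ultimately show ?thesis
    unfolding equitable_total_coloring_def by blast
qed

lemma simple_graph_corona:
  assumes "simple_graph G" and "simple_graph H"
  shows "simple_graph (corona G H)"
proof -
  have "card ((\<lambda>x. Inr (v, x) :: 'a + 'a \<times> 'b) ` e) = card e" for v e
    by (rule card_image) (simp add: inj_on_def)
  moreover have "card (Inl ` e :: ('a + 'a \<times> 'b) set) = card e" for e
    by (rule card_image) simp
  ultimately show ?thesis
    using assms unfolding simple_graph_def corona_def by (auto 0 3)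
qed

end

theory Submission
  imports Defs "HOL-Combinatorics.Transposition"
begin

text \<open>Let \<open>n\<close> be the number of vertices of \<open>H\<close> and use \<open>n + 4\<close> colors, one more than the degree of a
  vertex of \<open>G\<close> in the corona. Color the edges of \<open>G\<close> equitably and then its vertices greedily.
  Every vertex \<open>v\<close> of \<open>G\<close> now sees four special colors, and the joining edges at \<open>v\<close> have to use
  exactly the \<open>n\<close> free colors. In the copy of \<open>H\<close> at \<open>v\<close> the vertices use every free color once as
  well, and the edges are colored so that every color occurs \<open>q\<close> or \<open>q + 1\<close> times in the copy,
  where the set \<open>S v\<close> of the colors used \<open>q + 1\<close> times may be any set of the right size. Except
  for the vertices of \<open>G\<close>, these colorings come from one exchange argument: take a coloring with
  prescribed class sizes and as few clashing elements as possible; if there is enough room, a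
  clashing element could trade its color with another element, so none is left. Only graphs \<open>H\<close> on
  four or six vertices leave too little room for coloring their edges in this way.

  A color of \<open>m\<close> edges of \<open>G\<close> occurs on \<open>|V(G)| - m\<close> elements outside the copies, so its class has
  \<open>(q + 1) |V(G)| - m + |{v. i \<in> S v}|\<close> elements. The values of \<open>m\<close> differ by at most one, and
  choosing for \<open>S v\<close>, one vertex \<open>v\<close> after the other, the colors with the smallest classes so far
  keeps it that way.\<close>

section \<open>List colorings\<close>

definition list_coloring ::
  "('x \<Rightarrow> 'x \<Rightarrow> bool) \<Rightarrow> ('x \<Rightarrow> 'c set) \<Rightarrow> 'x set \<Rightarrow> 'c set \<Rightarrow> ('x \<Rightarrow> 'c) \<Rightarrow> bool" where
  "list_coloring R F X C c \<longleftrightarrow> (\<forall>x\<in>X. c x \<in> C - F x \<and> (\<forall>y\<in>X. R x y \<longrightarrow> c x \<noteq> c y))"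

abbreviation proper_coloring :: "('x \<Rightarrow> 'x \<Rightarrow> bool) \<Rightarrow> 'x set \<Rightarrow> 'c set \<Rightarrow> ('x \<Rightarrow> 'c) \<Rightarrow> bool" where
  "proper_coloring R \<equiv> list_coloring R (\<lambda>_. {})"

abbreviation class_size :: "'x set \<Rightarrow> ('x \<Rightarrow> 'c) \<Rightarrow> 'c \<Rightarrow> nat" where
  "class_size X c i \<equiv> card {x \<in> X. c x = i}"

definition clashing ::
  "('x \<Rightarrow> 'x \<Rightarrow> bool) \<Rightarrow> ('x \<Rightarrow> 'c set) \<Rightarrow> 'x set \<Rightarrow> ('x \<Rightarrow> 'c) \<Rightarrow> 'x set" where
  "clashing R F X c = {x \<in> X. c x \<in> F x \<or> (\<exists>y\<in>X. R x y \<and> c x = c y)}"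

lemma list_coloring_iff_clashing_empty:
  "list_coloring R F X C c \<longleftrightarrow> c ` X \<subseteq> C \<and> clashing R F X c = {}"
  by (auto simp: list_coloring_def clashing_def)

lemma greedy_list_coloring:
  fixes R :: "'x \<Rightarrow> 'x \<Rightarrow> bool" and F :: "'x \<Rightarrow> 'c set"
  assumes "finite X" and "symp R" and "irreflp_on X R"
    and "\<And>x. x \<in> X \<Longrightarrow> finite (F x)"
    and "\<And>x. x \<in> X \<Longrightarrow> card (F x) + card {y \<in> X. R x y} < card C"
  shows "\<exists>c. list_coloring R F X C c"
  using assms(1,3-5)
proof (induction X rule: finite_induct)
  case empty
  then show ?case by (simp add: list_coloring_def)
next
  case (insert x X)
  have "card (F y) + card {z \<in> X. R y z} < card C" if "y \<in> X" for y
  proof -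
    have "card {z \<in> X. R y z} \<le> card {z \<in> insert x X. R y z}"
      using insert.hyps(1) by (intro card_mono) auto
    then show ?thesis
      using insert.prems(3)[of y] that by simp
  qed
  moreover have "irreflp_on X R"
    using insert.prems(1) by (auto intro: irreflp_on_subset)
  ultimately obtain c where coloring: "list_coloring R F X C c"
    using insert.IH insert.prems(2) by auto
  let ?N = "{y \<in> X. R x y}"
  have "\<not> R x x"
    using insert.prems(1) by (auto simp: irreflp_on_def)
  then have "{y \<in> insert x X. R x y} = ?N" by auto
  moreover have "card (F x \<union> c ` ?N) \<le> card (F x) + card ?N"
    using card_Un_le[of "F x" "c ` ?N"] card_image_le[of ?N c] insert.hyps(1) by simp
  ultimately have "card (F x \<union> c ` ?N) < card C"
    using insert.prems(3)[of x] by simp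
  moreover have "finite (F x \<union> c ` ?N)"
    using insert.hyps(1) insert.prems(2) by simp
  ultimately obtain i where color: "i \<in> C" "i \<notin> F x \<union> c ` ?N"
    by (meson card_mono leD subsetI)
  have "c y \<noteq> i" if "y \<in> X" "R x y \<or> R y x" for y
    using color that sympD[OF \<open>symp R\<close>] by blast
  then have "list_coloring R F (insert x X) C (c(x := i))"
    using coloring color insert.hyps(2) \<open>\<not> R x x\<close> by (auto simp: list_coloring_def)
  then show ?case by blast
qed

section \<open>Colorings with prescribed class sizes\<close>

lemma class_size_eq_0:
  assumes "list_coloring R F X C c" and "i \<notin> C"
  shows "class_size X c i = 0"
proof -
  have none: "{x \<in> X. c x = i} = {}"
    using assms by (auto simp: list_coloring_def)
  show ?thesis
    unfolding none by simp
qed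

lemma card_classes:
  assumes "finite X" and "finite K"
  shows "card {x \<in> X. c x \<in> K} = (\<Sum>i\<in>K. class_size X c i)"
proof -
  have "{x \<in> X. c x \<in> K} = (\<Union>i\<in>K. {x \<in> X. c x = i})"
    by blast
  also have "card \<dots> = (\<Sum>i\<in>K. class_size X c i)"
    using assms by (intro card_UN_disjoint) auto
  finally show ?thesis .
qed

lemma card_neighbors_of_class_le:
  assumes "finite X" and "x \<in> X" and "\<And>z. z \<in> X \<Longrightarrow> card {y \<in> X. R z y} \<le> d"
  shows "card (\<Union>z\<in>{z \<in> X. c z = c x} - {x}. {y \<in> X. R z y}) \<le> d * (class_size X c (c x) - 1)"
proof -
  let ?Z = "{z \<in> X. c z = c x} - {x}"
  have "card (\<Union>z\<in>?Z. {y \<in> X. R z y}) \<le> (\<Sum>z\<in>?Z. card {y \<in> X. R z y})"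
    using assms(1) by (intro card_UN_le) simp
  also have "\<dots> \<le> card ?Z * d"
    using sum_bounded_above[of ?Z _ d] assms(3) by simp
  also have "card ?Z = class_size X c (c x) - 1"
    using assms(1,2) by (subst card_Diff_singleton) auto
  finally show ?thesis
    by (simp add: mult.commute)
qed

lemma class_size_bij_betw:
  assumes "bij_betw f X Y"
  shows "class_size X f i = of_bool (i \<in> Y)"
proof (cases "i \<in> Y")
  case True
  then obtain x where "x \<in> X" "f x = i"
    using assms by (auto simp: bij_betw_def)
  then have "{y \<in> X. f y = i} = {x}"
    using assms by (auto simp: bij_betw_def inj_on_def)
  then show ?thesis
    using True by simp
next
  case False
  then have none: "{y \<in> X. f y = i} = {}"
    using bij_betwE[OF assms] by auto
  show ?thesis
    unfolding none using False by simp
qed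

lemma exists_class_sizes:
  fixes g :: "'c \<Rightarrow> nat"
  assumes "finite X" and "finite C" and "sum g C = card X"
  shows "\<exists>c. c ` X \<subseteq> C \<and> (\<forall>i\<in>C. class_size X c i = g i)"
proof -
  let ?Y = "SIGMA i:C. {..<g i}"
  have "card ?Y = card X"
    using assms by (simp add: card_SigmaI)
  moreover have "finite ?Y"
    using \<open>finite C\<close> by simp
  ultimately obtain h where bij: "bij_betw h X ?Y"
    using \<open>finite X\<close> finite_same_card_bij by metis
  have "class_size X (fst \<circ> h) i = g i" if "i \<in> C" for i
  proof -
    have "inj_on h {x \<in> X. (fst \<circ> h) x = i}"
      using bij by (auto simp: bij_betw_def intro: inj_on_subset)
    then have "class_size X (fst \<circ> h) i = card (h ` {x \<in> X. (fst \<circ> h) x = i})"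
      by (simp add: card_image)
    also have "h ` {x \<in> X. (fst \<circ> h) x = i} = {y \<in> h ` X. fst y = i}"
      by auto
    also have "\<dots> = {i} \<times> {..<g i}"
      using that by (auto simp: bij_betw_imp_surj_on[OF bij])
    finally show ?thesis by simp
  qed
  moreover have "(fst \<circ> h) ` X \<subseteq> C"
    using bij_betwE[OF bij] by fastforce
  ultimately show ?thesis by blast
qed

lemma class_size_transpose:
  assumes "x \<in> X" and "y \<in> X"
  shows "class_size X (c \<circ> transpose x y) i = class_size X c i"
proof (rule bij_betw_same_card)
  show "bij_betw (transpose x y) {z \<in> X. (c \<circ> transpose x y) z = i} {z \<in> X. c z = i}"
    using assms by (intro bij_betw_byWitness[where f' = "transpose x y"]) (auto simp: transpose_def)
qed

lemma clashing_transpose_psubset: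
  assumes "symp R" and "irreflp_on X R" and x_clashing: "x \<in> clashing R F X c" and y_in: "y \<in> X"
    and "c y \<notin> F x" and "\<And>z. z \<in> X \<Longrightarrow> R x z \<Longrightarrow> c y \<noteq> c z"
    and "c x \<notin> F y" and "\<And>z. z \<in> X \<Longrightarrow> z \<noteq> x \<Longrightarrow> R y z \<Longrightarrow> c x \<noteq> c z"
  shows "clashing R F X (c \<circ> transpose x y) \<subset> clashing R F X c"
proof -
  let ?c = "c \<circ> transpose x y"
  have "x \<in> X"
    using x_clashing by (simp add: clashing_def)
  have "\<not> R x y" "\<not> R y x"
    using assms(6)[OF y_in] sympD[OF \<open>symp R\<close>] by auto
  have x_free: "x \<notin> clashing R F X ?c"
    using assms(5,6) \<open>\<not> R x y\<close> \<open>irreflp_on X R\<close> unfolding clashing_def irreflp_on_def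
    by (auto simp: transpose_def)
  have y_free: "y \<notin> clashing R F X ?c"
    using assms(7,8) \<open>\<not> R y x\<close> \<open>irreflp_on X R\<close> \<open>x \<in> X\<close> y_in unfolding clashing_def irreflp_on_def
    by (auto simp: transpose_def split: if_splits)
  have "z \<in> clashing R F X c" if z_clashing: "z \<in> clashing R F X ?c" for z
  proof -
    have fixed: "?c w = c w" if "w \<in> clashing R F X ?c" for w
      using that x_free y_free by (metis comp_apply transpose_apply_other)
    have "z \<in> X"
      using z_clashing by (simp add: clashing_def)
    consider (forbidden) "?c z \<in> F z" | (conflict) w where "w \<in> X" "R z w" "?c z = ?c w"
      using z_clashing unfolding clashing_def by blast
    then show ?thesis
    proof cases
      case forbidden
      then show ?thesis
        using fixed[OF z_clashing] \<open>z \<in> X\<close> by (simp add: clashing_def)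
    next
      case (conflict w)
      then have "w \<in> clashing R F X ?c"
        using \<open>z \<in> X\<close> sympD[OF \<open>symp R\<close>] unfolding clashing_def
        by (metis (mono_tags, lifting) mem_Collect_eq)
      then have "c z = c w"
        using conflict(3) fixed[OF z_clashing] fixed[of w] by metis
      then show ?thesis
        using conflict \<open>z \<in> X\<close> by (auto simp: clashing_def)
    qed
  qed
  then show ?thesis
    using x_clashing x_free by blast
qed

lemma clashing_imp_forbidden_or_neighbor:
  assumes "symp R" and "irreflp_on X R" and x_clashing: "x \<in> clashing R F X c"
  shows "c x \<in> F x \<or> (\<exists>z\<in>{z \<in> X. c z = c x} - {x}. R z x)"
proof (cases "c x \<in> F x")
  case False
  then obtain z where same_color: "z \<in> X" "R x z" "c x = c z"
    using x_clashing by (auto simp: clashing_def)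
  then have "z \<noteq> x"
    using irreflp_onD[OF \<open>irreflp_on X R\<close>] by auto
  then show ?thesis
    using same_color sympD[OF \<open>symp R\<close>] by auto
qed simp

context
  fixes R :: "'x \<Rightarrow> 'x \<Rightarrow> bool" and F :: "'x \<Rightarrow> 'c set" and g :: "'c \<Rightarrow> nat" and X C d
  assumes finite: "finite X" "finite C" and total: "sum g C = card X"
    and R_props: "symp R" "irreflp_on X R" and degree_le: "\<And>x. x \<in> X \<Longrightarrow> card {y \<in> X. R x y} \<le> d"
    and F_subset: "\<And>x. x \<in> X \<Longrightarrow> F x \<subseteq> C"
    and room: "\<And>x i K. x \<in> X \<Longrightarrow> K \<subseteq> C \<Longrightarrow> card K \<le> d \<Longrightarrow> i \<in> K \<union> F x \<Longrightarrow>
      sum g (K \<union> F x) + card {y \<in> X. i \<in> F y} + d * (g i - 1) \<le> card X"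
begin

text \<open>The elements that cannot trade colors with \<open>x\<close> are those of a color unsuitable for \<open>x\<close> and those
  for which the color of \<open>x\<close> is unsuitable. As \<open>x\<close> clashes, it belongs to both kinds.\<close>

lemma exists_swap_partner:
  assumes into_C: "c ` X \<subseteq> C" "\<And>i. i \<in> C \<Longrightarrow> class_size X c i = g i"
    and x_clashing: "x \<in> clashing R F X c"
  shows "\<exists>y\<in>X. c y \<notin> F x \<and> (\<forall>z\<in>X. R x z \<longrightarrow> c y \<noteq> c z) \<and>
    c x \<notin> F y \<and> (\<forall>z\<in>X. z \<noteq> x \<longrightarrow> R y z \<longrightarrow> c x \<noteq> c z)"
proof -
  define K where "K = c ` {y \<in> X. R x y}"
  define A where "A = {y \<in> X. c y \<in> K \<union> F x}"
  define N where "N = (\<Union>z\<in>{z \<in> X. c z = c x} - {x}. {y \<in> X. R z y})"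
  define B where "B = {y \<in> X. c x \<in> F y} \<union> N"
  have "x \<in> X" and color_in: "c x \<in> K \<union> F x"
    using x_clashing unfolding clashing_def K_def by auto
  have K_subset: "K \<subseteq> C" "card K \<le> d"
    using into_C(1) card_image_le[of "{y \<in> X. R x y}" c] degree_le[OF \<open>x \<in> X\<close>] finite
    unfolding K_def by auto
  have KF_subset: "K \<union> F x \<subseteq> C"
    using K_subset(1) F_subset[OF \<open>x \<in> X\<close>] by blast
  then have "card A = sum g (K \<union> F x)"
    unfolding A_def using finite into_C(2)
    by (subst card_classes) (auto intro: finite_subset sum.cong)
  moreover have "class_size X c (c x) = g (c x)"
    using KF_subset color_in into_C(2) by blast
  then have "card N \<le> d * (g (c x) - 1)"
    unfolding N_def using card_neighbors_of_class_le[OF finite(1) \<open>x \<in> X\<close>, of R d c] degree_le by simp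
  then have "card B \<le> card {y \<in> X. c x \<in> F y} + d * (g (c x) - 1)"
    unfolding B_def using card_Un_le[of "{y \<in> X. c x \<in> F y}" N] by simp
  ultimately have "card A + card B \<le> card X"
    using room[OF \<open>x \<in> X\<close> K_subset color_in] by simp
  moreover have "x \<in> A \<inter> B"
    using clashing_imp_forbidden_or_neighbor[OF R_props x_clashing] \<open>x \<in> X\<close> color_in
    by (auto simp: A_def B_def N_def)
  moreover have finite_blocked: "finite A" "finite B"
    using finite by (auto simp: A_def B_def N_def)
  ultimately have "card (A \<union> B) < card X"
    using card_Un_Int[OF finite_blocked] card_gt_0_iff[of "A \<inter> B"] by auto
  then obtain y where "y \<in> X" "y \<notin> A" "y \<notin> B"
    using finite_blocked by (meson UnCI card_mono finite_UnI leD subsetI)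
  then show ?thesis
    using sympD[OF R_props(1)] unfolding A_def B_def N_def K_def by (intro bexI[of _ y]) force+
qed

lemma list_coloring_with_class_sizes:
  "\<exists>c. list_coloring R F X C c \<and> (\<forall>i\<in>C. class_size X c i = g i)"
proof -
  define sized where "sized c \<longleftrightarrow> c ` X \<subseteq> C \<and> (\<forall>i\<in>C. class_size X c i = g i)" for c
  have "\<exists>c. sized c"
    unfolding sized_def by (rule exists_class_sizes[OF finite total])
  then obtain c where c_sized: "sized c"
    and least: "\<And>c'. sized c' \<Longrightarrow> card (clashing R F X c) \<le> card (clashing R F X c')"
    using ex_has_least_nat[of sized _ "\<lambda>c. card (clashing R F X c)"] by blast
  have "clashing R F X c = {}"
  proof (rule ccontr)
    assume "clashing R F X c \<noteq> {}"
    then obtain x where x_clashing: "x \<in> clashing R F X c" by blast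
    then have "x \<in> X" by (simp add: clashing_def)
    obtain y where partner: "y \<in> X" "c y \<notin> F x" "\<forall>z\<in>X. R x z \<longrightarrow> c y \<noteq> c z"
      "c x \<notin> F y" "\<forall>z\<in>X. z \<noteq> x \<longrightarrow> R y z \<longrightarrow> c x \<noteq> c z"
      using exists_swap_partner[OF _ _ x_clashing] c_sized unfolding sized_def by blast
    have "clashing R F X (c \<circ> transpose x y) \<subset> clashing R F X c"
      by (rule clashing_transpose_psubset) (use R_props x_clashing partner in auto)
    moreover have "finite (clashing R F X c)"
      using finite by (simp add: clashing_def)
    ultimately have "card (clashing R F X (c \<circ> transpose x y)) < card (clashing R F X c)"
      by (simp add: psubset_card_mono)
    moreover have "(c \<circ> transpose x y) ` X = c ` X"
      using \<open>x \<in> X\<close> partner(1) unfolding image_comp[symmetric] by simp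
    then have "sized (c \<circ> transpose x y)"
      using c_sized class_size_transpose[OF \<open>x \<in> X\<close> partner(1), of c] by (simp add: sized_def)
    ultimately show False
      using least by fastforce
  qed
  then show ?thesis
    using c_sized by (auto simp: list_coloring_iff_clashing_empty sized_def)
qed

end

lemma bij_betw_avoiding:
  assumes "finite X" and "finite Y" and card: "card X = card Y" and "\<And>x. x \<in> X \<Longrightarrow> F x \<subseteq> Y"
    and room: "\<And>x y. x \<in> X \<Longrightarrow> y \<in> F x \<Longrightarrow> card (F x) + card {z \<in> X. y \<in> F z} \<le> card X"
  shows "\<exists>f. bij_betw f X Y \<and> (\<forall>x\<in>X. f x \<notin> F x)"
proof -
  have "\<exists>f. list_coloring (\<lambda>_ _. False) F X Y f \<and> (\<forall>y\<in>Y. class_size X f y = 1)"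
  proof (rule list_coloring_with_class_sizes[where d = 0])
    fix x y and K :: "'b set"
    assume "x \<in> X" "K \<subseteq> Y" "card K \<le> 0" "y \<in> K \<union> F x"
    moreover have "K = {}"
      using \<open>K \<subseteq> Y\<close> \<open>card K \<le> 0\<close> \<open>finite Y\<close> by (simp add: finite_subset)
    ultimately show "(\<Sum>y\<in>K \<union> F x. 1) + card {z \<in> X. y \<in> F z} + 0 * (1 - 1) \<le> card X"
      using room by simp
  qed (use assms in \<open>auto simp: symp_def irreflp_on_def\<close>)
  then obtain f where f_avoids: "\<forall>x\<in>X. f x \<in> Y - F x" and class_size_one: "\<forall>y\<in>Y. class_size X f y = 1"
    unfolding list_coloring_def by blast
  have "Y \<subseteq> f ` X"
  proof
    fix y assume "y \<in> Y"
    then have "card {x \<in> X. f x = y} \<noteq> 0"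
      using class_size_one by simp
    then have "{x \<in> X. f x = y} \<noteq> {}"
      by (metis card.empty)
    then show "y \<in> f ` X" by blast
  qed
  then have "f ` X = Y" using f_avoids by blast
  moreover from this have "inj_on f X"
    using \<open>finite X\<close> card by (simp add: eq_card_imp_inj_on)
  ultimately show ?thesis
    using f_avoids by (auto simp: bij_betw_def)
qed

lemma proper_coloring_with_class_sizes:
  fixes R :: "'x \<Rightarrow> 'x \<Rightarrow> bool" and g :: "'c \<Rightarrow> nat"
  assumes "finite X" and "finite C" and "sum g C = card X" and "symp R" and "irreflp_on X R"
    and "\<And>x. x \<in> X \<Longrightarrow> card {y \<in> X. R x y} \<le> d"
    and room: "\<And>i K. K \<subseteq> C \<Longrightarrow> card K \<le> d \<Longrightarrow> i \<in> K \<Longrightarrow> d * (g i - 1) \<le> sum g (C - K)"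
  shows "\<exists>c. proper_coloring R X C c \<and> (\<forall>i\<in>C. class_size X c i = g i)"
proof (rule list_coloring_with_class_sizes[where d = d])
  fix x i K
  assume "K \<subseteq> C" "card K \<le> d" "i \<in> K \<union> {}"
  then show "sum g (K \<union> {}) + card {y \<in> X. i \<in> {}} + d * (g i - 1) \<le> card X"
    using room[of K i] sum.subset_diff[of K C g] \<open>finite C\<close> \<open>sum g C = card X\<close> by simp
qed (use assms in auto)

definition balanced_on :: "'c set \<Rightarrow> ('c \<Rightarrow> 'n::linordered_semidom) \<Rightarrow> bool" where
  "balanced_on C h \<longleftrightarrow> (\<forall>i\<in>C. \<forall>j\<in>C. h i \<le> h j + 1)"

lemma equitable_coloring:
  fixes R :: "'x \<Rightarrow> 'x \<Rightarrow> bool" and C :: "'c set"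
  assumes "finite X" and "finite C" and "C \<noteq> {}" and "symp R" and "irreflp_on X R"
    and "\<And>x. x \<in> X \<Longrightarrow> card {y \<in> X. R x y} \<le> d" and two_d_le: "2 * d \<le> card C"
  shows "\<exists>c. proper_coloring R X C c \<and> balanced_on C (class_size X c)"
proof -
  define t where "t = card X div card C"
  have "card X mod card C \<le> card C"
    using assms(2,3) by (simp add: card_gt_0_iff less_imp_le)
  then obtain S where S_subset: "S \<subseteq> C" "card S = card X mod card C"
    using obtain_subset_with_card_n by metis
  let ?g = "\<lambda>i. t + of_bool (i \<in> S)"
  have "sum ?g C = card C * t + card S"
    using S_subset(1) \<open>finite C\<close> by (simp add: sum.distrib of_bool_def sum.If_cases Int_absorb1)
  then have total: "sum ?g C = card X"
    by (simp add: S_subset(2) t_def)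
  have "\<exists>c. proper_coloring R X C c \<and> (\<forall>i\<in>C. class_size X c i = ?g i)"
  proof (rule proper_coloring_with_class_sizes[OF _ _ total, where d = d])
    fix i K assume K_le: "K \<subseteq> C" "card K \<le> d"
    have "d * (?g i - 1) \<le> card (C - K) * t"
      using K_le two_d_le \<open>finite C\<close> by (intro mult_mono) (auto simp: card_Diff_subset finite_subset)
    also have "\<dots> \<le> sum ?g (C - K)"
      using sum_bounded_below[of "C - K" t ?g] by simp
    finally show "d * (?g i - 1) \<le> sum ?g (C - K)" .
  qed (use assms in auto)
  then show ?thesis by (fastforce simp: balanced_on_def)
qed

section \<open>Balanced families of sets\<close>

lemma balanced_on_uminus:
  fixes f :: "'c \<Rightarrow> nat"
  assumes "balanced_on C f"
  shows "balanced_on C (\<lambda>i. - int (f i))"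
  unfolding balanced_on_def
proof (intro ballI)
  fix i j assume "i \<in> C" "j \<in> C"
  then have "f j \<le> f i + 1"
    using assms by (simp add: balanced_on_def)
  then show "- int (f i) \<le> - int (f j) + 1"
    by linarith
qed

lemma exists_comparable_subset:
  assumes "finite C" and "Z \<subseteq> C" and "r \<le> card C"
  shows "\<exists>T\<subseteq>C. card T = r \<and> (T \<subseteq> Z \<or> Z \<subseteq> T)"
proof (cases "r \<le> card Z")
  case True
  then show ?thesis
    using assms(2) by (meson obtain_subset_with_card_n order_trans)
next
  case False
  then have "\<exists>T. Z \<subseteq> T \<and> T \<subseteq> C \<and> card T = r"
    using assms by (intro exists_subset_between) auto
  then show ?thesis by blast
qed

lemma exists_subset_preserving_balance:
  fixes h :: "'c \<Rightarrow> int"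
  assumes "finite C" and "r \<le> card C" and balanced: "balanced_on C h"
  shows "\<exists>T\<subseteq>C. card T = r \<and> balanced_on C (\<lambda>i. h i + of_bool (i \<in> T))"
proof -
  define Z where "Z = {i \<in> C. \<forall>j\<in>C. h i \<le> h j}"
  then have "Z \<subseteq> C"
    by blast
  then obtain T where T_props: "T \<subseteq> C" "card T = r" "T \<subseteq> Z \<or> Z \<subseteq> T"
    using exists_comparable_subset[OF assms(1) _ assms(2)] by blast
  have le_outside: "h i \<le> h j" if in_out: "i \<in> C" "j \<in> C" "i \<in> T" "j \<notin> T" for i j
  proof (cases "i \<in> Z")
    case True
    then show ?thesis
      using in_out(2) by (simp add: Z_def)
  next
    case False
    then have "j \<notin> Z"
      using T_props(3) in_out by blast
    then obtain l where "l \<in> C" "h l < h j"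
      using in_out(2) by (auto simp: Z_def not_le)
    moreover have "h i \<le> h l + 1"
      using balanced \<open>l \<in> C\<close> in_out(1) by (simp add: balanced_on_def)
    ultimately show ?thesis by linarith
  qed
  have "h i + of_bool (i \<in> T) \<le> h j + of_bool (j \<in> T) + 1" if "i \<in> C" "j \<in> C" for i j
  proof -
    have "h i \<le> h j + 1"
      using balanced that by (simp add: balanced_on_def)
    then show ?thesis
      using le_outside[OF that] by auto
  qed
  then have "balanced_on C (\<lambda>i. h i + of_bool (i \<in> T))"
    unfolding balanced_on_def by blast
  then show ?thesis
    using T_props by blast
qed

lemma exists_balanced_family_of_subsets:
  fixes h :: "'c \<Rightarrow> int"
  assumes "finite V" and "finite C" and "r \<le> card C" and "balanced_on C h"
  shows "\<exists>S. (\<forall>v\<in>V. S v \<subseteq> C \<and> card (S v) = r) \<and>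
    balanced_on C (\<lambda>i. h i + int (card {v \<in> V. i \<in> S v}))"
  using assms(1)
proof (induction V rule: finite_induct)
  case empty
  then show ?case using assms(4) by simp
next
  case (insert w V)
  then obtain S where S_subsets: "\<forall>v\<in>V. S v \<subseteq> C \<and> card (S v) = r"
    and balanced: "balanced_on C (\<lambda>i. h i + int (card {v \<in> V. i \<in> S v}))"
    by blast
  obtain T where T_subset: "T \<subseteq> C" "card T = r"
    and step: "balanced_on C (\<lambda>i. h i + int (card {v \<in> V. i \<in> S v}) + of_bool (i \<in> T))"
    using exists_subset_preserving_balance[OF assms(2,3) balanced] by blast
  have "{v \<in> insert w V. i \<in> (S(w := T)) v} = (if i \<in> T then {w} else {}) \<union> {v \<in> V. i \<in> S v}" for i
    using insert.hyps(2) by auto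
  then have "card {v \<in> insert w V. i \<in> (S(w := T)) v} = card {v \<in> V. i \<in> S v} + of_bool (i \<in> T)" for i
    using insert.hyps by simp
  then have "balanced_on C (\<lambda>i. h i + int (card {v \<in> insert w V. i \<in> (S(w := T)) v}))"
    using step by (simp add: add.assoc)
  moreover have "\<forall>v\<in>insert w V. (S(w := T)) v \<subseteq> C \<and> card ((S(w := T)) v) = r"
    using S_subsets T_subset by simp
  ultimately show ?case by blast
qed

section \<open>Matchings\<close>

definition matching :: "('x \<Rightarrow> 'x \<Rightarrow> bool) \<Rightarrow> 'x set \<Rightarrow> 'x set set \<Rightarrow> bool" where
  "matching R X M \<longleftrightarrow> finite M \<and> pairwise disjnt M \<and>
    (\<forall>e\<in>M. e \<subseteq> X \<and> card e = 2 \<and> (\<forall>x\<in>e. \<forall>y\<in>e. x \<noteq> y \<longrightarrow> R x y))"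

lemma matching_subset: "matching R X M \<Longrightarrow> N \<subseteq> M \<Longrightarrow> matching R X N"
  unfolding matching_def by (meson finite_subset pairwise_subset subsetD)

lemma exists_submatching_containing:
  assumes matching: "matching R X M" and e_in: "e \<in> M" and n_le: "n \<le> card M"
  shows "\<exists>N. matching R X N \<and> card N = n \<and> (N \<noteq> {} \<longrightarrow> e \<in> N)"
proof (cases "n = 0")
  case True
  then show ?thesis
    by (intro exI[of _ "{}"]) (simp add: matching_def)
next
  case False
  then have "\<exists>N. {e} \<subseteq> N \<and> N \<subseteq> M \<and> card N = n"
    using matching e_in n_le by (intro exists_subset_between) (auto simp: matching_def)
  then show ?thesis
    using matching_subset[OF matching] by blast
qed

lemma card_Union_matching:
  assumes "matching R X M"
  shows "card (\<Union>M) = 2 * card M"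
proof -
  have "finite e" if "e \<in> M" for e
    using assms that by (auto simp: matching_def intro: card_ge_0_finite)
  then have "card (\<Union>M) = sum card M"
    using assms by (intro card_Union_disjoint) (auto simp: matching_def)
  then show ?thesis
    using assms by (simp add: matching_def)
qed

lemma matching_insert:
  assumes "matching R X M" and "symp R"
    and "x \<in> X - \<Union>M" and "y \<in> X - \<Union>M" and "x \<noteq> y" and "R x y"
  shows "matching R X (insert {x, y} M)" and "card (insert {x, y} M) = Suc (card M)"
proof -
  show "matching R X (insert {x, y} M)"
    using assms by (auto simp: matching_def pairwise_insert disjnt_def dest: sympD)
  have "{x, y} \<notin> M"
    using assms(3) by blast
  then show "card (insert {x, y} M) = Suc (card M)"
    using assms(1) by (simp add: matching_def)
qed

lemma matching_exchange:
  assumes matching: "matching R X M" and "symp R" and uv_in: "{u, v} \<in> M" "u \<noteq> v"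
    and unmatched: "x \<in> X - \<Union>M" "y \<in> X - \<Union>M" "x \<noteq> y" and related: "R x u" "R y v"
  shows "\<exists>M'. matching R X M' \<and> card M' = Suc (card M)"
proof -
  let ?N = "M - {{u, v}}"
  have submatching: "matching R X ?N"
    using matching by (rule matching_subset) blast
  have "pairwise disjnt M" "{u, v} \<subseteq> X"
    using matching uv_in(1) by (auto simp: matching_def)
  then have "disjnt {u, v} e" if "e \<in> ?N" for e
    using pairwiseD[OF _ uv_in(1), of disjnt e] that by blast
  then have "u \<notin> \<Union>?N" "v \<notin> \<Union>?N"
    by (auto simp: disjnt_def)
  moreover have "x \<noteq> u" "x \<noteq> v" "y \<noteq> u" "y \<noteq> v"
    using unmatched uv_in(1) by blast+
  ultimately have "matching R X (insert {x, u} ?N)" "card (insert {x, u} ?N) = Suc (card ?N)"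
    and "y \<in> X - \<Union>(insert {x, u} ?N)" "v \<in> X - \<Union>(insert {x, u} ?N)" "y \<noteq> v"
    using matching_insert[OF submatching \<open>symp R\<close>, of x u] \<open>{u, v} \<subseteq> X\<close> unmatched related uv_in(2)
    by auto
  moreover have "Suc (card ?N) = card M"
    using matching uv_in(1) by (intro card_Suc_Diff1) (auto simp: matching_def)
  ultimately show ?thesis
    using matching_insert[OF _ \<open>symp R\<close> _ _ _ \<open>R y v\<close>, of X "insert {x, u} ?N"] by metis
qed

lemma exists_matching_edge_hit_thrice:
  assumes matching: "matching R X M" and "A \<subseteq> \<Union>M" and "B \<subseteq> \<Union>M"
    and "2 * card M < card A + card B"
  shows "\<exists>e\<in>M. 2 < card (A \<inter> e) + card (B \<inter> e)"
proof (rule ccontr)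
  assume "\<not> ?thesis"
  then have "(\<Sum>e\<in>M. card (A \<inter> e) + card (B \<inter> e)) \<le> card M * 2"
    using sum_bounded_above[of M _ "2 :: nat"] by (simp add: not_less)
  moreover have "(\<Sum>e\<in>M. card (D \<inter> e)) = card D" if "D \<subseteq> \<Union>M" for D
  proof -
    have "finite e" if "e \<in> M" for e
      using matching that by (auto simp: matching_def intro: card_ge_0_finite)
    then have "card (\<Union>e\<in>M. D \<inter> e) = (\<Sum>e\<in>M. card (D \<inter> e))"
      using matching by (intro card_UN_disjoint) (auto simp: matching_def pairwise_def disjnt_def)
    moreover have "(\<Union>e\<in>M. D \<inter> e) = D"
      using that by blast
    ultimately show ?thesis by simp
  qed
  ultimately show False
    using assms by (simp add: sum.distrib)
qed

lemma distinct_representatives_of_pair: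
  assumes "card e = 2" and "2 < card (A \<inter> e) + card (B \<inter> e)"
  shows "\<exists>u v. e = {u, v} \<and> u \<noteq> v \<and> u \<in> A \<and> v \<in> B"
proof -
  obtain u v where e_eq: "e = {u, v}" "u \<noteq> v"
    using \<open>card e = 2\<close> by (auto simp: card_2_iff)
  have "D \<inter> e = (if u \<in> D then {u} else {}) \<union> (if v \<in> D then {v} else {})" for D
    using e_eq by auto
  then have "u \<in> A \<and> v \<in> B \<or> v \<in> A \<and> u \<in> B"
    using assms(2) e_eq by (auto split: if_splits)
  then show ?thesis
    using e_eq by (metis insert_commute)
qed

text \<open>If the unmatched elements are pairwise unrelated, then some edge of the matching has at least
  three of the four possible relations to two unmatched elements \<open>x\<close> and \<open>y\<close>, and can be
  replaced by two edges.\<close>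

lemma matching_augment:
  assumes "finite X" and "symp R" and irrefl: "irreflp_on X R"
    and degree_ge: "\<And>x. x \<in> X \<Longrightarrow> d \<le> card {y \<in> X. R x y}" and card_X: "2 * d \<le> card X"
    and matching: "matching R X M" and "card M < d"
  shows "\<exists>M'. matching R X M' \<and> card M' = Suc (card M)"
proof (cases "\<exists>x\<in>X - \<Union>M. \<exists>y\<in>X - \<Union>M. R x y")
  case True
  then obtain x y where unmatched: "x \<in> X - \<Union>M" "y \<in> X - \<Union>M" "R x y"
    by blast
  then have "x \<noteq> y"
    using irreflp_onD[OF irrefl] by auto
  then show ?thesis
    using matching_insert[OF matching \<open>symp R\<close> unmatched(1,2) _ unmatched(3)] by blast
next
  case False
  have "\<Union>M \<subseteq> X"
    using matching by (auto simp: matching_def)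
  then have "card (X - \<Union>M) = card X - 2 * card M"
    using card_Union_matching[OF matching] \<open>finite X\<close> by (simp add: card_Diff_subset finite_subset)
  then have "\<not> card (X - \<Union>M) \<le> Suc 0"
    using card_X \<open>card M < d\<close> by simp
  then obtain x y where unmatched: "x \<in> X - \<Union>M" "y \<in> X - \<Union>M" "x \<noteq> y"
    using \<open>finite X\<close> by (auto simp: card_le_Suc0_iff_eq)
  define N where "N z = {w \<in> X. R z w}" for z
  have "N x \<subseteq> \<Union>M" "N y \<subseteq> \<Union>M"
    using False unmatched by (auto simp: N_def)
  moreover have "2 * card M < card (N x) + card (N y)"
    using degree_ge[of x] degree_ge[of y] unmatched \<open>card M < d\<close> by (simp add: N_def)
  ultimately obtain e where e_hit: "e \<in> M" "2 < card (N x \<inter> e) + card (N y \<inter> e)"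
    using exists_matching_edge_hit_thrice[OF matching] by blast
  moreover have "card e = 2"
    using matching e_hit(1) by (simp add: matching_def)
  ultimately obtain u v where "e = {u, v}" "u \<noteq> v" "u \<in> N x" "v \<in> N y"
    using distinct_representatives_of_pair by blast
  then show ?thesis
    using matching_exchange[OF matching \<open>symp R\<close> _ _ unmatched] e_hit(1) by (auto simp: N_def)
qed

lemma exists_matching_of_min_degree:
  assumes "finite X" and "symp R" and "irreflp_on X R"
    and "\<And>x. x \<in> X \<Longrightarrow> d \<le> card {y \<in> X. R x y}" and "2 * d \<le> card X"
  shows "\<exists>M. matching R X M \<and> card M = d"
proof -
  have "\<exists>M. matching R X M \<and> card M = t" if "t \<le> d" for t
    using that
  proof (induction t)
    case 0
    then show ?case by (intro exI[of _ "{}"]) (simp add: matching_def)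
  next
    case (Suc t)
    then obtain M where "matching R X M" "card M = t" by auto
    then show ?case
      using matching_augment[OF assms] Suc.prems by fastforce
  qed
  then show ?thesis by simp
qed

section \<open>Colorings with classes of one or two elements\<close>

lemma exists_coloring_with_classes:
  assumes cover: "(\<Union>i\<in>C. M i) = X"
    and disjoint: "\<And>i j. i \<in> C \<Longrightarrow> j \<in> C \<Longrightarrow> i \<noteq> j \<Longrightarrow> M i \<inter> M j = {}"
    and irrefl: "irreflp_on X R"
    and independent: "\<And>i x y. i \<in> C \<Longrightarrow> x \<in> M i \<Longrightarrow> y \<in> M i \<Longrightarrow> x \<noteq> y \<Longrightarrow> \<not> R x y"
  shows "\<exists>c. proper_coloring R X C c \<and> (\<forall>i\<in>C. {x \<in> X. c x = i} = M i)"
proof -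
  have "\<forall>x\<in>X. \<exists>i\<in>C. x \<in> M i"
    using cover by blast
  then obtain c where class_of: "\<forall>x\<in>X. c x \<in> C \<and> x \<in> M (c x)"
    by metis
  have "{x \<in> X. c x = i} = M i" if "i \<in> C" for i
    using class_of cover disjoint[OF that] that by blast
  moreover have "proper_coloring R X C c"
    using class_of independent irreflp_onD[OF irrefl] unfolding list_coloring_def
    by (metis DiffI empty_iff)
  ultimately show ?thesis by blast
qed

lemma exists_bij_betw_on_subset:
  assumes "finite A" and "finite B" and "card A = card B"
    and "A' \<subseteq> A" and "B' \<subseteq> B" and "card A' = card B'"
  shows "\<exists>f. bij_betw f A B \<and> f ` A' = B'"
proof -
  have finite_subsets: "finite A'" "finite B'"
    using assms by (auto intro: finite_subset)
  obtain g where bij_subsets: "bij_betw g A' B'"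
    using finite_same_card_bij finite_subsets assms(6) by blast
  moreover have "card (A - A') = card (B - B')"
    using assms finite_subsets by (simp add: card_Diff_subset)
  then obtain h where "bij_betw h (A - A') (B - B')"
    using finite_same_card_bij[of "A - A'" "B - B'"] assms(1,2) by auto
  ultimately have "bij_betw (\<lambda>x. if x \<in> A' then g x else h x) (A' \<union> (A - A')) (B' \<union> (B - B'))"
    by (intro bij_betw_disjoint_Un) auto
  moreover have "(\<lambda>x. if x \<in> A' then g x else h x) ` A' = B'"
    using bij_subsets by (auto simp: bij_betw_def)
  ultimately show ?thesis
    using assms(4,5) by (metis Un_Diff_cancel Un_absorb1)
qed

lemma exists_indexing_by_pairs_and_singletons:
  assumes "finite X" and "finite A" and "finite B" and "A \<inter> B = {}" and matching: "matching Q X P"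
    and card_eq: "card A = card P" "card B = card (X - \<Union>P)"
    and B_subset: "B' \<subseteq> B" and T_props: "T \<subseteq> X - \<Union>P" "card B' = card T"
  shows "\<exists>M. (\<Union>i\<in>A \<union> B. M i) = X \<and> (\<forall>i\<in>A \<union> B. \<forall>j\<in>A \<union> B. i \<noteq> j \<longrightarrow> M i \<inter> M j = {}) \<and>
    (\<forall>i\<in>A. M i \<in> P) \<and> (\<forall>i\<in>B. \<exists>x. M i = {x}) \<and> (\<forall>i\<in>B'. M i \<subseteq> T)"
proof -
  have "finite P" and "\<Union>P \<subseteq> X"
    using matching by (auto simp: matching_def)
  obtain f where bij_f: "bij_betw f A P"
    using finite_same_card_bij \<open>finite A\<close> \<open>finite P\<close> card_eq(1) by blast
  obtain g where bij_g: "bij_betw g B (X - \<Union>P)" "g ` B' = T"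
    using exists_bij_betw_on_subset[OF \<open>finite B\<close> _ card_eq(2) B_subset T_props] \<open>finite X\<close> by auto
  define M where "M i = (if i \<in> A then f i else {g i})" for i
  have f_in: "f i \<in> P" if "i \<in> A" for i
    using that bij_betwE[OF bij_f] by blast
  have g_in: "g i \<in> X - \<Union>P" if "i \<in> B" for i
    using that bij_betwE[OF bij_g(1)] by blast
  have "(\<Union>i\<in>A \<union> B. M i) = \<Union>(f ` A) \<union> g ` B"
    using \<open>A \<inter> B = {}\<close> by (auto simp: M_def)
  also have "\<dots> = X"
    using bij_betw_imp_surj_on[OF bij_f] bij_betw_imp_surj_on[OF bij_g(1)] \<open>\<Union>P \<subseteq> X\<close> by auto
  finally have "(\<Union>i\<in>A \<union> B. M i) = X" .
  moreover have "M i \<inter> M j = {}" if "i \<in> A \<union> B" "j \<in> A \<union> B" "i \<noteq> j" for i j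
  proof -
    have "f i \<inter> f j = {}" if "i \<in> A" "j \<in> A"
      using f_in that \<open>i \<noteq> j\<close> matching bij_betw_imp_inj_on[OF bij_f]
      by (metis disjnt_def inj_onD matching_def pairwiseD)
    moreover have "g i \<noteq> g j" if "i \<in> B" "j \<in> B"
      using that \<open>i \<noteq> j\<close> bij_betw_imp_inj_on[OF bij_g(1)] by (metis inj_onD)
    ultimately show ?thesis
      using f_in g_in that unfolding M_def by auto
  qed
  moreover have "M i \<in> P" if "i \<in> A" for i
    using f_in that by (simp add: M_def)
  moreover have "M i = {g i}" if "i \<in> B" for i
    using \<open>A \<inter> B = {}\<close> that by (auto simp: M_def)
  ultimately show ?thesis
    using B_subset bij_g(2) by (intro exI[of _ M]) auto
qed

lemma exists_coloring_with_pairs_and_singletons: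
  assumes "finite X" and "finite A" and "finite B" and "A \<inter> B = {}" and irrefl: "irreflp_on X R"
    and matching: "matching Q X P" and not_R: "\<And>x y. Q x y \<Longrightarrow> \<not> R x y"
    and card_eq: "card A = card P" "card B = card (X - \<Union>P)"
    and B_subset: "B' \<subseteq> B" and T_props: "T \<subseteq> X - \<Union>P" "card B' = card T"
  shows "\<exists>c. proper_coloring R X (A \<union> B) c \<and>
    (\<forall>i. class_size X c i = 2 * of_bool (i \<in> A) + of_bool (i \<in> B)) \<and> (\<forall>x\<in>X. c x \<in> B' \<longrightarrow> x \<in> T)"
proof -
  obtain M where cover: "(\<Union>i\<in>A \<union> B. M i) = X"
    and disjoint: "\<forall>i\<in>A \<union> B. \<forall>j\<in>A \<union> B. i \<noteq> j \<longrightarrow> M i \<inter> M j = {}"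
    and M_props: "\<forall>i\<in>A. M i \<in> P" "\<forall>i\<in>B. \<exists>x. M i = {x}" "\<forall>i\<in>B'. M i \<subseteq> T"
    using exists_indexing_by_pairs_and_singletons[OF assms(1-4) matching card_eq B_subset T_props]
    by (elim exE conjE)
  have "\<not> R x y" if "i \<in> A \<union> B" "x \<in> M i" "y \<in> M i" "x \<noteq> y" for i x y
  proof -
    have "M i \<in> P"
      using that M_props(1,2) by fastforce
    then show ?thesis
      using that matching not_R by (auto simp: matching_def)
  qed
  then obtain c where coloring: "proper_coloring R X (A \<union> B) c"
    and classes: "\<forall>i\<in>A \<union> B. {x \<in> X. c x = i} = M i"
    using exists_coloring_with_classes[OF cover _ irrefl] disjoint by blast
  have "class_size X c i = 2 * of_bool (i \<in> A) + of_bool (i \<in> B)" for i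
  proof -
    consider (pair) "i \<in> A" "i \<notin> B" | (singleton) "i \<in> B" "i \<notin> A" | (unused) "i \<notin> A \<union> B"
      using \<open>A \<inter> B = {}\<close> by blast
    then show ?thesis
    proof cases
      case pair
      then show ?thesis
        using classes M_props(1) matching by (simp add: matching_def)
    next
      case singleton
      then show ?thesis
        using classes M_props(2) by fastforce
    next
      case unused
      then show ?thesis
        using class_size_eq_0[OF coloring] by simp
    qed
  qed
  moreover have "x \<in> T" if "x \<in> X" "c x \<in> B'" for x
    using that classes M_props(3) B_subset by blast
  ultimately show ?thesis
    using coloring by blast
qed

section \<open>Graphs and total colorings\<close>

abbreviation adjacent_edges :: "'a set \<Rightarrow> 'a set \<Rightarrow> bool" where
  "adjacent_edges e f \<equiv> e \<noteq> f \<and> e \<inter> f \<noteq> {}"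

abbreviation incident_edges :: "'a ugraph \<Rightarrow> 'a \<Rightarrow> 'a set set" where
  "incident_edges G v \<equiv> {e \<in> edges G. v \<in> e}"

lemma symp_adjacent_edges: "symp adjacent_edges"
  by (auto simp: symp_def)

lemma irreflp_on_adjacent_edges: "irreflp_on E adjacent_edges"
  by (simp add: irreflp_on_def)

lemma finite_verts: "simple_graph G \<Longrightarrow> finite (verts G)"
  by (simp add: simple_graph_def)

lemma edge_subset_verts: "simple_graph G \<Longrightarrow> e \<in> edges G \<Longrightarrow> e \<subseteq> verts G"
  by (simp add: simple_graph_def)

lemma card_edge: "simple_graph G \<Longrightarrow> e \<in> edges G \<Longrightarrow> card e = 2"
  by (simp add: simple_graph_def)

lemma edge_nonempty: "simple_graph G \<Longrightarrow> e \<in> edges G \<Longrightarrow> e \<noteq> {}"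
  using card_edge by fastforce

lemma finite_edges:
  assumes "simple_graph G"
  shows "finite (edges G)"
proof (rule finite_subset)
  show "edges G \<subseteq> Pow (verts G)"
    using edge_subset_verts[OF assms] by blast
qed (simp add: finite_verts[OF assms])

lemma edge_doubletonD:
  assumes "simple_graph G" and "{u, v} \<in> edges G"
  shows "u \<in> verts G" and "v \<in> verts G" and "u \<noteq> v"
  using edge_subset_verts[OF assms] card_edge[OF assms] by auto

lemma symp_neighbors: "symp (\<lambda>u v. {u, v} \<in> edges G)"
  by (simp add: symp_def insert_commute)

lemma irreflp_on_neighbors:
  assumes "simple_graph G"
  shows "irreflp_on V (\<lambda>u v. {u, v} \<in> edges G)"
proof (rule irreflp_onI)
  show "{v, v} \<notin> edges G" for v
    using edge_doubletonD(3)[OF assms, of v v] by blast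
qed

lemma sum_degree:
  assumes "simple_graph G"
  shows "(\<Sum>v\<in>verts G. degree G v) = 2 * card (edges G)"
proof -
  have "(\<Sum>v\<in>verts G. card (incident_edges G v)) = (\<Sum>e\<in>edges G. 2)"
  proof (rule sum_multicount_gen[OF finite_verts[OF assms] finite_edges[OF assms]], rule ballI)
    fix e assume e_in: "e \<in> edges G"
    then have "{v \<in> verts G. v \<in> e} = e"
      using edge_subset_verts[OF assms] by blast
    then show "card {v \<in> verts G. v \<in> e} = 2"
      using card_edge[OF assms e_in] by simp
  qed
  then show ?thesis
    by (simp add: degree_def)
qed

lemma card_neighbors_le_degree:
  assumes "simple_graph G"
  shows "card {u \<in> verts G. {v, u} \<in> edges G} \<le> degree G v"
  unfolding degree_def
  by (rule card_inj_on_le[of "\<lambda>u. {v, u}"])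
    (use finite_edges[OF assms] in \<open>auto simp: inj_on_def doubleton_eq_iff\<close>)

lemma degree_less_card_verts:
  assumes "simple_graph G" and v_in: "v \<in> verts G"
  shows "degree G v < card (verts G)"
proof -
  have "incident_edges G v \<subseteq> (\<lambda>w. {v, w}) ` (verts G - {v})"
  proof
    fix e assume "e \<in> incident_edges G v"
    then have e_incident: "e \<in> edges G" "v \<in> e" by auto
    then obtain w where "e = {v, w}" "w \<noteq> v"
      using card_edge[OF assms(1) e_incident(1)] by (auto simp: card_2_iff)
    then show "e \<in> (\<lambda>w. {v, w}) ` (verts G - {v})"
      using edge_subset_verts[OF assms(1) e_incident(1)] by auto
  qed
  then have "degree G v \<le> card (verts G - {v})"
    unfolding degree_def using finite_verts[OF assms(1)] by (intro surj_card_le) auto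
  then show ?thesis
    using card_Diff1_less[OF finite_verts[OF assms(1)] v_in] by simp
qed

lemma card_verts_cubic_ge:
  assumes "cubic_graph G"
  shows "4 \<le> card (verts G)"
proof -
  obtain v where "v \<in> verts G"
    using assms by (auto simp: cubic_graph_def simple_graph_def)
  then show ?thesis
    using assms degree_less_card_verts[of G v] by (simp add: cubic_graph_def)
qed

lemma card_adjacent_edges_le:
  assumes "simple_graph G" and degree_le: "\<And>v. v \<in> verts G \<Longrightarrow> degree G v \<le> D" and e_in: "e \<in> edges G"
  shows "card {f \<in> edges G. adjacent_edges e f} \<le> 2 * (D - 1)"
proof -
  obtain u v where e_eq: "e = {u, v}" "u \<noteq> v"
    using card_edge[OF assms(1) e_in] by (auto simp: card_2_iff)
  have other: "card (incident_edges G w - {e}) \<le> D - 1" if "w \<in> e" for w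
    using finite_edges[OF assms(1)] edge_subset_verts[OF assms(1) e_in] degree_le[of w] e_in that
    by (subst card_Diff_singleton) (auto simp: degree_def)
  have "{f \<in> edges G. adjacent_edges e f} = (incident_edges G u - {e}) \<union> (incident_edges G v - {e})"
    using e_eq by auto
  then show ?thesis
    using card_Un_le[of "incident_edges G u - {e}" "incident_edges G v - {e}"] other[of u] other[of v] e_eq
    by simp
qed

definition distinct_colors_at :: "'a ugraph \<Rightarrow> ('a + 'a set \<Rightarrow> nat) \<Rightarrow> 'a \<Rightarrow> bool" where
  "distinct_colors_at G c v \<longleftrightarrow> inj_on (\<lambda>e. c (Inr e)) (incident_edges G v) \<and>
    c (Inl v) \<notin> (\<lambda>e. c (Inr e)) ` incident_edges G v"

lemma total_coloring_iff:
  assumes "simple_graph G"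
  shows "total_coloring G k c \<longleftrightarrow>
    (\<forall>z\<in>verts G <+> edges G. c z < k) \<and>
    (\<forall>u v. {u, v} \<in> edges G \<longrightarrow> c (Inl u) \<noteq> c (Inl v)) \<and>
    (\<forall>v\<in>verts G. distinct_colors_at G c v)"
    (is "_ \<longleftrightarrow> ?bounded \<and> ?vertices \<and> ?incident")
proof
  assume coloring: "total_coloring G k c"
  then have ?bounded by (simp add: total_coloring_def)
  moreover have ?vertices
    using coloring edge_doubletonD(1,2)[OF assms] by (simp add: total_coloring_def)
  moreover have ?incident
    using coloring unfolding total_coloring_def distinct_colors_at_def inj_on_def by blast
  ultimately show "?bounded \<and> ?vertices \<and> ?incident" by blast
next
  assume coloring: "?bounded \<and> ?vertices \<and> ?incident"
  have "c (Inr e) \<noteq> c (Inr f)" if adjacent: "e \<in> edges G" "f \<in> edges G" "adjacent_edges e f" for e f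
  proof -
    obtain v where "v \<in> e" "v \<in> f"
      using adjacent by blast
    moreover from this have "v \<in> verts G"
      using edge_subset_verts[OF assms adjacent(1)] by blast
    with coloring have "inj_on (\<lambda>e. c (Inr e)) (incident_edges G v)"
      by (simp add: distinct_colors_at_def)
    ultimately show ?thesis
      using adjacent inj_onD[of "\<lambda>e. c (Inr e)" "incident_edges G v" e f] by blast
  qed
  then show "total_coloring G k c"
    using coloring unfolding total_coloring_def distinct_colors_at_def by blast
qed

lemma total_coloring_case_sum:
  assumes "simple_graph G" and "proper_coloring (\<lambda>u v. {u, v} \<in> edges G) (verts G) {..<k} a"
    and "proper_coloring adjacent_edges (edges G) {..<k} b"
    and "\<And>e v. e \<in> edges G \<Longrightarrow> v \<in> e \<Longrightarrow> a v \<noteq> b e"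
  shows "total_coloring G k (case_sum a b)"
  using assms(2-4) by (auto simp: total_coloring_def list_coloring_def)

definition colors_at :: "'a ugraph \<Rightarrow> ('a + 'a set \<Rightarrow> nat) \<Rightarrow> 'a \<Rightarrow> nat set" where
  "colors_at G c v = insert (c (Inl v)) ((\<lambda>e. c (Inr e)) ` incident_edges G v)"

lemma colors_at_subset:
  assumes "total_coloring G k c" and "v \<in> verts G"
  shows "colors_at G c v \<subseteq> {..<k}"
  using assms by (auto simp: total_coloring_def colors_at_def)

lemma card_colors_at:
  assumes "simple_graph G" and "total_coloring G k c" and "v \<in> verts G"
  shows "card (colors_at G c v) = degree G v + 1"
  using assms finite_edges[OF assms(1)]
  by (simp add: total_coloring_iff distinct_colors_at_def colors_at_def degree_def card_image)

lemma max_degree_less_colors: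
  assumes "simple_graph G" and coloring: "total_coloring G k c"
  shows "max_degree G < k"
proof -
  have "degree G v < k" if "v \<in> verts G" for v
    using card_mono[OF finite_lessThan colors_at_subset[OF coloring that]] card_colors_at[OF assms that]
    by simp
  then show ?thesis
    using assms(1) by (simp add: max_degree_def simple_graph_def)
qed

lemma card_color_class:
  assumes "simple_graph G"
  shows "card (color_class G c i) =
    class_size (verts G) (\<lambda>v. c (Inl v)) i + class_size (edges G) (\<lambda>e. c (Inr e)) i"
proof -
  have "color_class G c i = {v \<in> verts G. c (Inl v) = i} <+> {e \<in> edges G. c (Inr e) = i}"
    by (auto simp: color_class_def)
  then show ?thesis
    using finite_verts[OF assms] finite_edges[OF assms] by (simp add: card_Plus)
qed

lemma card_verts_seeing_color:
  assumes "simple_graph G" and coloring: "total_coloring G k c"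
  shows "card {v \<in> verts G. i \<in> colors_at G c v}
    = card (color_class G c i) + class_size (edges G) (\<lambda>e. c (Inr e)) i"
proof -
  let ?V = "{v \<in> verts G. c (Inl v) = i}" and ?E = "{e \<in> edges G. c (Inr e) = i}"
  have "pairwise disjnt ?E"
    using coloring unfolding total_coloring_def pairwise_def disjnt_def by blast
  moreover have finite_edge: "finite e" if "e \<in> ?E" for e
    using finite_verts[OF assms(1)] edge_subset_verts[OF assms(1)] that finite_subset by blast
  ultimately have "card (\<Union>?E) = sum card ?E"
    by (intro card_Union_disjoint) auto
  also have "\<dots> = 2 * card ?E"
    using card_edge[OF assms(1)] by simp
  finally have "card (\<Union>?E) = 2 * card ?E" .
  moreover have "c (Inl v) \<noteq> c (Inr e)" if "v \<in> verts G" "e \<in> edges G" "v \<in> e" for v e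
    using coloring that by (simp add: total_coloring_def)
  then have "?V \<inter> \<Union>?E = {}"
    by force
  moreover have "finite (\<Union>?E)"
    using finite_edges[OF assms(1)] finite_edge by auto
  ultimately have "card (?V \<union> \<Union>?E) = card ?V + 2 * card ?E"
    using finite_verts[OF assms(1)] by (simp add: card_Un_disjoint)
  moreover have "{v \<in> verts G. i \<in> colors_at G c v} = ?V \<union> \<Union>?E"
    using edge_subset_verts[OF assms(1)] by (auto simp: colors_at_def)
  ultimately show ?thesis
    by (simp add: card_color_class[OF assms(1)])
qed

lemma exists_total_coloring_balanced_edges:
  assumes "simple_graph G" and degree_le: "\<And>v. v \<in> verts G \<Longrightarrow> degree G v \<le> D"
    and k_ge: "4 * (D - 1) \<le> k" "2 * D < k"
  shows "\<exists>c. total_coloring G k c \<and> balanced_on {..<k} (class_size (edges G) (\<lambda>e. c (Inr e)))"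
proof -
  have "\<exists>b. proper_coloring adjacent_edges (edges G) {..<k} b \<and>
    balanced_on {..<k} (class_size (edges G) b)"
    using finite_edges[OF assms(1)] k_ge card_adjacent_edges_le[OF assms(1) degree_le]
      symp_adjacent_edges irreflp_on_adjacent_edges
    by (intro equitable_coloring[where d = "2 * (D - 1)"]) (auto simp: lessThan_empty_iff)
  then obtain b where edge_coloring: "proper_coloring adjacent_edges (edges G) {..<k} b"
    and balanced: "balanced_on {..<k} (class_size (edges G) b)"
    by blast
  let ?neighbors = "\<lambda>u v. {u, v} \<in> edges G" and ?seen = "\<lambda>v. b ` incident_edges G v"
  have "\<exists>a. list_coloring ?neighbors ?seen (verts G) {..<k} a"
  proof (rule greedy_list_coloring[OF finite_verts[OF assms(1)] symp_neighbors
        irreflp_on_neighbors[OF assms(1)]])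
    fix v assume v_in: "v \<in> verts G"
    show "finite (b ` incident_edges G v)"
      using finite_edges[OF assms(1)] by simp
    have "card (b ` incident_edges G v) \<le> degree G v"
      unfolding degree_def using finite_edges[OF assms(1)] by (simp add: card_image_le)
    then show "card (b ` incident_edges G v) + card {u \<in> verts G. {v, u} \<in> edges G} < card {..<k}"
      using card_neighbors_le_degree[OF assms(1), of v] degree_le[OF v_in] k_ge(2) by simp
  qed
  then obtain a where vertex_coloring: "list_coloring ?neighbors ?seen (verts G) {..<k} a"
    by blast
  have "total_coloring G k (case_sum a b)"
  proof (rule total_coloring_case_sum[OF assms(1) _ edge_coloring])
    show "a v \<noteq> b e" if "e \<in> edges G" "v \<in> e" for e v
      using vertex_coloring edge_subset_verts[OF assms(1) that(1)] that unfolding list_coloring_def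
      by blast
  qed (use vertex_coloring in \<open>auto simp: list_coloring_def\<close>)
  then show ?thesis
    using balanced by (intro exI[of _ "case_sum a b"]) simp
qed

section \<open>Total colorings of the corona\<close>

abbreviation copy_edge :: "'a \<Rightarrow> 'b set \<Rightarrow> ('a + 'a \<times> 'b) set" where
  "copy_edge v e \<equiv> (\<lambda>x. Inr (v, x)) ` e"

abbreviation join_edge :: "'a \<Rightarrow> 'b \<Rightarrow> ('a + 'a \<times> 'b) set" where
  "join_edge v x \<equiv> {Inl v, Inr (v, x)}"

lemma verts_corona:
  "verts (corona G H) = Inl ` verts G \<union> (\<Union>v\<in>verts G. (\<lambda>x. Inr (v, x)) ` verts H)"
  by (auto simp: corona_def)

lemma edges_corona:
  "edges (corona G H) = (`) Inl ` edges G \<union> (\<Union>v\<in>verts G. copy_edge v ` edges H) \<union>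
    (\<Union>v\<in>verts G. join_edge v ` verts H)"
  by (auto simp: corona_def)

lemma copy_edge_eq_iff:
  assumes "e \<noteq> {}"
  shows "copy_edge v e = copy_edge w f \<longleftrightarrow> v = w \<and> e = f"
proof
  assume edges_eq: "copy_edge v e = copy_edge w f"
  obtain x where "x \<in> e" using assms by blast
  then have "Inr (v, x) \<in> copy_edge w f" using edges_eq by blast
  then have "v = w" by auto
  moreover have "e = f"
    using edges_eq unfolding \<open>v = w\<close> by (simp add: inj_image_eq_iff inj_on_def)
  ultimately show "v = w \<and> e = f" ..
qed simp

lemma incident_edges_corona_Inl:
  assumes "v \<in> verts G"
  shows "incident_edges (corona G H) (Inl v) = (`) Inl ` incident_edges G v \<union> join_edge v ` verts H"
  using assms by (auto simp: edges_corona)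

lemma incident_edges_corona_Inr:
  assumes "v \<in> verts G" and "x \<in> verts H"
  shows "incident_edges (corona G H) (Inr (v, x)) =
    insert (join_edge v x) (copy_edge v ` incident_edges H x)"
  using assms by (auto simp: edges_corona)

lemma degree_corona_Inl:
  assumes simple_G: "simple_graph G" and simple_H: "simple_graph H" and v_in: "v \<in> verts G"
  shows "degree (corona G H) (Inl v) = degree G v + card (verts H)"
proof -
  let ?B = "(`) Inl ` incident_edges G v :: ('a + 'a \<times> 'b) set set" and ?J = "join_edge v ` verts H"
  have "card ?B = degree G v"
    unfolding degree_def by (rule card_image) (simp add: inj_on_def inj_image_eq_iff)
  moreover have "card ?J = card (verts H)"
    by (rule card_image) (auto simp: inj_on_def doubleton_eq_iff)
  moreover have "card (?B \<union> ?J) = card ?B + card ?J"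
    using finite_edges[OF simple_G] finite_verts[OF simple_H] by (intro card_Un_disjoint) auto
  ultimately show ?thesis
    by (simp add: degree_def incident_edges_corona_Inl[OF v_in])
qed

lemma degree_corona_Inr:
  assumes simple_H: "simple_graph H" and v_in: "v \<in> verts G" and x_in: "x \<in> verts H"
  shows "degree (corona G H) (Inr (v, x)) = degree H x + 1"
proof -
  let ?C = "copy_edge v ` incident_edges H x"
  have "card ?C = degree H x"
    unfolding degree_def
    by (rule card_image) (use edge_nonempty[OF simple_H] in \<open>simp add: inj_on_def copy_edge_eq_iff\<close>)
  moreover have "join_edge v x \<notin> ?C" by auto
  moreover have "finite ?C"
    using finite_edges[OF simple_H] by simp
  ultimately show ?thesis
    by (simp add: degree_def incident_edges_corona_Inr[OF v_in x_in])
qed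

lemma max_degree_corona:
  assumes simple_G: "simple_graph G" and simple_H: "simple_graph H"
  shows "max_degree (corona G H) = max (max_degree G + card (verts H)) (max_degree H + 1)"
proof -
  have nonempty: "verts G \<noteq> {}" "verts H \<noteq> {}"
    using simple_G simple_H by (auto simp: simple_graph_def)
  note finite_GH = finite_verts[OF simple_G] finite_verts[OF simple_H]
  have "degree (corona G H) ` verts (corona G H) =
    (\<lambda>v. degree (corona G H) (Inl v)) ` verts G \<union>
    (\<Union>v\<in>verts G. (\<lambda>x. degree (corona G H) (Inr (v, x))) ` verts H)"
    by (auto simp: verts_corona)
  also have "(\<lambda>v. degree (corona G H) (Inl v)) ` verts G =
    (\<lambda>d. d + card (verts H)) ` degree G ` verts G"
    by (simp add: degree_corona_Inl[OF simple_G simple_H] image_image)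
  also have "(\<Union>v\<in>verts G. (\<lambda>x. degree (corona G H) (Inr (v, x))) ` verts H) =
    Suc ` degree H ` verts H"
    using nonempty(1) by (simp add: degree_corona_Inr[OF simple_H] image_image)
  finally have "max_degree (corona G H) =
    max (Max ((\<lambda>d. d + card (verts H)) ` degree G ` verts G)) (Max (Suc ` degree H ` verts H))"
    using nonempty finite_GH by (simp add: max_degree_def Max_Un)
  moreover have "Max ((\<lambda>d. d + card (verts H)) ` degree G ` verts G) = max_degree G + card (verts H)"
    unfolding max_degree_def using nonempty finite_GH
    by (intro mono_Max_commute[symmetric]) (auto simp: mono_def)
  moreover have "Max (Suc ` degree H ` verts H) = max_degree H + 1"
    unfolding max_degree_def using nonempty finite_GH
    by (subst mono_Max_commute[symmetric]) (auto simp: mono_def)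
  ultimately show ?thesis by simp
qed

text \<open>The last summand \<open>verts H\<close> indexes the joining edges.\<close>

definition corona_index ::
  "'a ugraph \<Rightarrow> 'b ugraph \<Rightarrow> (('a + 'a set) + 'a \<times> (('b + 'b set) + 'b)) set" where
  "corona_index G H = (verts G <+> edges G) <+> verts G \<times> ((verts H <+> edges H) <+> verts H)"

fun corona_element ::
  "('a + 'a set) + 'a \<times> (('b + 'b set) + 'b) \<Rightarrow> ('a + 'a \<times> 'b) + ('a + 'a \<times> 'b) set" where
  "corona_element (Inl (Inl v)) = Inl (Inl v)"
| "corona_element (Inl (Inr e)) = Inr (Inl ` e)"
| "corona_element (Inr (v, Inl (Inl x))) = Inl (Inr (v, x))"
| "corona_element (Inr (v, Inl (Inr f))) = Inr (copy_edge v f)"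
| "corona_element (Inr (v, Inr x)) = Inr (join_edge v x)"

fun index_coloring ::
  "('a + 'a set \<Rightarrow> nat) \<Rightarrow> ('a \<Rightarrow> 'b + 'b set \<Rightarrow> nat) \<Rightarrow> ('a \<Rightarrow> 'b \<Rightarrow> nat) \<Rightarrow>
    ('a + 'a set) + 'a \<times> (('b + 'b set) + 'b) \<Rightarrow> nat" where
  "index_coloring c d l (Inl z) = c z"
| "index_coloring c d l (Inr (v, Inl z)) = d v z"
| "index_coloring c d l (Inr (v, Inr x)) = l v x"

definition corona_coloring ::
  "'a ugraph \<Rightarrow> 'b ugraph \<Rightarrow> ('a + 'a set \<Rightarrow> nat) \<Rightarrow> ('a \<Rightarrow> 'b + 'b set \<Rightarrow> nat) \<Rightarrow> ('a \<Rightarrow> 'b \<Rightarrow> nat) \<Rightarrow>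
    ('a + 'a \<times> 'b) + ('a + 'a \<times> 'b) set \<Rightarrow> nat" where
  "corona_coloring G H c d l = index_coloring c d l \<circ> inv_into (corona_index G H) corona_element"

lemma corona_index_iff:
  "Inl (Inl v) \<in> corona_index G H \<longleftrightarrow> v \<in> verts G"
  "Inl (Inr e) \<in> corona_index G H \<longleftrightarrow> e \<in> edges G"
  "Inr (v, Inl (Inl x)) \<in> corona_index G H \<longleftrightarrow> v \<in> verts G \<and> x \<in> verts H"
  "Inr (v, Inl (Inr f)) \<in> corona_index G H \<longleftrightarrow> v \<in> verts G \<and> f \<in> edges H"
  "Inr (v, Inr x) \<in> corona_index G H \<longleftrightarrow> v \<in> verts G \<and> x \<in> verts H"
  by (auto simp: corona_index_def)

lemma corona_element_image:
  "corona_element ` corona_index G H = verts (corona G H) <+> edges (corona G H)"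
proof -
  have "corona_index G H = Inl ` Inl ` verts G \<union> Inl ` Inr ` edges G \<union>
      (\<Union>v\<in>verts G. (\<lambda>x. Inr (v, Inl (Inl x))) ` verts H \<union> (\<lambda>f. Inr (v, Inl (Inr f))) ` edges H \<union>
        (\<lambda>x. Inr (v, Inr x)) ` verts H)"
    by (auto simp: corona_index_def)
  then show ?thesis
    by (simp add: verts_corona edges_corona Plus_def image_Un image_UN image_image UN_Un_distrib Un_ac)
qed

lemma inj_on_corona_element:
  assumes "simple_graph G" and "simple_graph H"
  shows "inj_on corona_element (corona_index G H)"
proof -
  have "e \<noteq> {}" "Inl ` e \<noteq> copy_edge v f" "copy_edge v f \<noteq> Inl ` e"
    if "e \<in> edges G" for e v and f :: "'b set"
    using edge_nonempty[OF assms(1) that] by auto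
  moreover have "f \<noteq> {}" if "f \<in> edges H" for f
    using edge_nonempty[OF assms(2) that] .
  ultimately show ?thesis
    by (auto simp: inj_on_def corona_index_def inj_image_eq_iff doubleton_eq_iff copy_edge_eq_iff)
qed

lemma corona_coloring_element:
  assumes "simple_graph G" and "simple_graph H" and "w \<in> corona_index G H"
  shows "corona_coloring G H c d l (corona_element w) = index_coloring c d l w"
  using inv_into_f_f[OF inj_on_corona_element[OF assms(1,2)] assms(3)]
  by (simp add: corona_coloring_def)

context
  fixes G :: "'a ugraph" and H :: "'b ugraph" and k c d l
  assumes simple_G: "simple_graph G" and simple_H: "simple_graph H"
    and coloring_G: "total_coloring G k c"
    and coloring_H: "\<And>v. v \<in> verts G \<Longrightarrow> total_coloring H k (d v)"
    and vertices_differ: "\<And>v x. v \<in> verts G \<Longrightarrow> x \<in> verts H \<Longrightarrow> c (Inl v) \<noteq> d v (Inl x)"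
    and inj_joins: "\<And>v. v \<in> verts G \<Longrightarrow> inj_on (l v) (verts H)"
    and join_colors: "\<And>v x. v \<in> verts G \<Longrightarrow> x \<in> verts H \<Longrightarrow>
      l v x \<in> {..<k} - colors_at G c v - colors_at H (d v) x"
begin

lemma corona_coloring_simps:
  "v \<in> verts G \<Longrightarrow> corona_coloring G H c d l (Inl (Inl v)) = c (Inl v)"
  "e \<in> edges G \<Longrightarrow> corona_coloring G H c d l (Inr (Inl ` e)) = c (Inr e)"
  "v \<in> verts G \<Longrightarrow> x \<in> verts H \<Longrightarrow> corona_coloring G H c d l (Inl (Inr (v, x))) = d v (Inl x)"
  "v \<in> verts G \<Longrightarrow> f \<in> edges H \<Longrightarrow> corona_coloring G H c d l (Inr (copy_edge v f)) = d v (Inr f)"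
  "v \<in> verts G \<Longrightarrow> x \<in> verts H \<Longrightarrow> corona_coloring G H c d l (Inr (join_edge v x)) = l v x"
  using corona_coloring_element[OF simple_G simple_H, of "Inl (Inl v)" c d l]
    corona_coloring_element[OF simple_G simple_H, of "Inl (Inr e)" c d l]
    corona_coloring_element[OF simple_G simple_H, of "Inr (v, Inl (Inl x))" c d l]
    corona_coloring_element[OF simple_G simple_H, of "Inr (v, Inl (Inr f))" c d l]
    corona_coloring_element[OF simple_G simple_H, of "Inr (v, Inr x)" c d l]
  by (simp_all add: corona_index_iff)

lemma corona_coloring_less:
  assumes "z \<in> verts (corona G H) <+> edges (corona G H)"
  shows "corona_coloring G H c d l z < k"
proof -
  obtain w where w_index: "w \<in> corona_index G H" "z = corona_element w"
    using assms unfolding corona_element_image[symmetric] by blast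
  have "c y < k" if "y \<in> verts G <+> edges G" for y
    using coloring_G that by (simp add: total_coloring_def)
  moreover have "d v y < k" if "v \<in> verts G" "y \<in> verts H <+> edges H" for v y
    using coloring_H that by (simp add: total_coloring_def)
  moreover have "l v x < k" if "v \<in> verts G" "x \<in> verts H" for v x
    using join_colors[OF that] by simp
  ultimately have "index_coloring c d l w < k"
    using w_index(1) unfolding corona_index_def by (auto simp: InlI InrI)
  then show ?thesis
    using w_index corona_coloring_element[OF simple_G simple_H] by simp
qed

lemma corona_coloring_adjacent_vertices:
  assumes "{s, t} \<in> edges (corona G H)"
  shows "corona_coloring G H c d l (Inl s) \<noteq> corona_coloring G H c d l (Inl t)"
proof -
  consider (base) e where "e \<in> edges G" "{s, t} = Inl ` e"
    | (copy) v e where "v \<in> verts G" "e \<in> edges H" "{s, t} = copy_edge v e"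
    | (join) v x where "v \<in> verts G" "x \<in> verts H" "{s, t} = join_edge v x"
    using assms by (auto simp: edges_corona)
  then show ?thesis
  proof cases
    case base
    then obtain u v where endpoints: "s = Inl u" "t = Inl v" by blast
    then have "Inl ` e = (Inl ` {u, v} :: ('a + 'a \<times> 'b) set)"
      using base(2) by simp
    then have "e = {u, v}"
      by (simp only: inj_image_eq_iff[OF inj_Inl])
    then show ?thesis
      using base(1) endpoints coloring_G edge_doubletonD[OF simple_G, of u v]
      by (simp add: corona_coloring_simps total_coloring_iff[OF simple_G])
  next
    case copy
    then obtain x y where endpoints: "s = Inr (v, x)" "t = Inr (v, y)" by blast
    then have "e = {x, y}"
      using copy(3) copy_edge_eq_iff[of "{x, y}" v v e] by simp
    then show ?thesis
      using copy(1,2) endpoints coloring_H edge_doubletonD[OF simple_H, of x y]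
      by (simp add: corona_coloring_simps total_coloring_iff[OF simple_H])
  next
    case join
    then show ?thesis
      using vertices_differ[of v x] by (auto simp: doubleton_eq_iff corona_coloring_simps)
  qed
qed

lemma distinct_colors_at_Inl:
  assumes v_in: "v \<in> verts G"
  shows "distinct_colors_at (corona G H) (corona_coloring G H c d l) (Inl v)"
proof -
  let ?c = "\<lambda>f. corona_coloring G H c d l (Inr f)"
  let ?B = "(`) Inl ` incident_edges G v :: ('a + 'a \<times> 'b) set set" and ?J = "join_edge v ` verts H"
  have distinct: "distinct_colors_at G c v"
    using coloring_G v_in by (simp add: total_coloring_iff[OF simple_G])
  have image: "?c ` ?B = (\<lambda>e. c (Inr e)) ` incident_edges G v" "?c ` ?J = l v ` verts H"
    using v_in by (simp_all add: image_image corona_coloring_simps cong: image_cong_simp)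
  have joins_new: "?c ` ?J \<inter> colors_at G c v = {}"
    unfolding image using join_colors[OF v_in] by blast
  have "inj_on (?c \<circ> (`) Inl) (incident_edges G v)"
    using distinct unfolding distinct_colors_at_def
    by (subst inj_on_cong[where g = "\<lambda>e. c (Inr e)"]) (simp_all add: corona_coloring_simps)
  then have "inj_on ?c ?B"
    by (rule inj_on_imageI)
  moreover have "inj_on (?c \<circ> join_edge v) (verts H)"
    using inj_joins[OF v_in]
    by (subst inj_on_cong[where g = "l v"]) (simp_all add: corona_coloring_simps v_in)
  then have "inj_on ?c ?J"
    by (rule inj_on_imageI)
  moreover have "?c ` ?B \<inter> ?c ` ?J = {}"
    using joins_new unfolding colors_at_def image(1) by blast
  ultimately have "inj_on ?c (?B \<union> ?J)"
    unfolding inj_on_Un by blast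
  moreover have "c (Inl v) \<notin> ?c ` ?B"
    using distinct unfolding image distinct_colors_at_def by blast
  moreover have "c (Inl v) \<notin> ?c ` ?J"
    using joins_new unfolding colors_at_def by blast
  ultimately show ?thesis
    unfolding distinct_colors_at_def incident_edges_corona_Inl[OF v_in] image_Un
    by (simp add: corona_coloring_simps v_in)
qed

lemma distinct_colors_at_Inr:
  assumes v_in: "v \<in> verts G" and x_in: "x \<in> verts H"
  shows "distinct_colors_at (corona G H) (corona_coloring G H c d l) (Inr (v, x))"
proof -
  let ?c = "\<lambda>f. corona_coloring G H c d l (Inr f)"
  let ?C = "copy_edge v ` incident_edges H x"
  have distinct: "distinct_colors_at H (d v) x"
    using coloring_H[OF v_in] x_in by (simp add: total_coloring_iff[OF simple_H])
  have copy_color: "?c (copy_edge v e) = d v (Inr e)" if "e \<in> incident_edges H x" for e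
    using that v_in by (simp add: corona_coloring_simps)
  then have image: "?c ` ?C = (\<lambda>e. d v (Inr e)) ` incident_edges H x"
    by (simp add: image_image)
  have join_new: "l v x \<notin> colors_at H (d v) x"
    using join_colors[OF v_in x_in] by blast
  have "inj_on (?c \<circ> copy_edge v) (incident_edges H x)"
    using distinct copy_color unfolding distinct_colors_at_def
    by (subst inj_on_cong[where g = "\<lambda>e. d v (Inr e)"]) simp_all
  then have "inj_on ?c ?C"
    by (rule inj_on_imageI)
  moreover have "?c (join_edge v x) \<notin> ?c ` ?C"
    using join_new v_in x_in unfolding image by (simp add: colors_at_def corona_coloring_simps)
  ultimately have "inj_on ?c (insert (join_edge v x) ?C)"
    by (auto simp only: inj_on_insert)
  moreover have "d v (Inl x) \<notin> ?c ` ?C"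
    using distinct unfolding image distinct_colors_at_def by blast
  ultimately show ?thesis
    using join_new v_in x_in unfolding distinct_colors_at_def incident_edges_corona_Inr[OF v_in x_in]
    by (simp add: colors_at_def corona_coloring_simps)
qed

lemma total_coloring_corona: "total_coloring (corona G H) k (corona_coloring G H c d l)"
  unfolding total_coloring_iff[OF simple_graph_corona[OF simple_G simple_H]]
proof (intro conjI ballI allI impI)
  fix w assume "w \<in> verts (corona G H)"
  then consider v where "v \<in> verts G" "w = Inl v"
    | v x where "v \<in> verts G" "x \<in> verts H" "w = Inr (v, x)"
    by (auto simp: verts_corona)
  then show "distinct_colors_at (corona G H) (corona_coloring G H c d l) w"
    by cases (use distinct_colors_at_Inl distinct_colors_at_Inr in blast)+
qed (use corona_coloring_less corona_coloring_adjacent_vertices in blast)+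

end

lemma card_color_class_corona:
  fixes G :: "'a ugraph" and H :: "'b ugraph"
  assumes simple_G: "simple_graph G" and simple_H: "simple_graph H"
  shows "card (color_class (corona G H) (corona_coloring G H c d l) i) = card (color_class G c i) +
    (\<Sum>v\<in>verts G. card (color_class H (d v) i) + class_size (verts H) (l v) i)"
proof -
  let ?W = "{w \<in> corona_index G H. index_coloring c d l w = i}"
  have "color_class (corona G H) (corona_coloring G H c d l) i = corona_element ` ?W"
    unfolding color_class_def corona_element_image[symmetric]
    using corona_coloring_element[OF simple_G simple_H] by auto
  moreover have "inj_on corona_element ?W"
    using inj_on_corona_element[OF simple_G simple_H] by (rule inj_on_subset) blast
  ultimately have "card (color_class (corona G H) (corona_coloring G H c d l) i) = card ?W"
    by (simp add: card_image)
  also have "?W = color_class G c i <+>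
      (SIGMA v:verts G. color_class H (d v) i <+> {x \<in> verts H. l v x = i})"
    unfolding corona_index_def color_class_def by (auto elim!: PlusE)
  also have "card \<dots> = card (color_class G c i) +
      (\<Sum>v\<in>verts G. card (color_class H (d v) i) + class_size (verts H) (l v) i)"
  proof -
    have "finite (color_class G c i)" "finite (color_class H (d v) i)" for v
      using finite_verts[OF simple_G] finite_edges[OF simple_G]
        finite_verts[OF simple_H] finite_edges[OF simple_H]
      by (auto simp: color_class_def)
    then show ?thesis
      using finite_verts[OF simple_G] finite_verts[OF simple_H] by (simp add: card_Plus card_SigmaI)
  qed
  finally show ?thesis .
qed

section \<open>Coloring a copy of a cubic graph\<close>

text \<open>In the copy belonging to \<open>v\<close>, the colors of \<open>v\<close> and of the edges at \<open>v\<close> in \<open>G\<close> are special,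
  and the extra colors are those used once more than the others.\<close>

locale cubic_copy =
  fixes H :: "'b ugraph" and special extra :: "nat set"
  assumes cubic: "cubic_graph H"
    and special: "special \<subseteq> {..<card (verts H) + 4}" "card special = 4"
    and extra: "extra \<subseteq> {..<card (verts H) + 4}"
      "card extra = (card (verts H) + card (edges H)) mod (card (verts H) + 4)"
begin

abbreviation n :: nat where
  "n \<equiv> card (verts H)"

abbreviation colors :: "nat set" where
  "colors \<equiv> {..<n + 4}"

definition q :: nat where
  "q = (n + card (edges H)) div (n + 4)"

lemma simple: "simple_graph H"
  using cubic by (simp add: cubic_graph_def)

lemma degree_eq: "x \<in> verts H \<Longrightarrow> degree H x = 3"
  using cubic by (simp add: cubic_graph_def)

lemma card_edges: "2 * card (edges H) = 3 * n"
  using sum_degree[OF simple] by (simp add: degree_eq)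

lemma n_ge: "4 \<le> n"
  by (rule card_verts_cubic_ge[OF cubic])

lemma n_cases: "n = 4 \<or> n = 6 \<or> 8 \<le> n"
  using card_edges n_ge by presburger

lemma q_eq: "q = (if n < 16 then 1 else 2)"
  unfolding q_def using card_edges n_ge by (auto intro!: div_nat_eqI)

lemma card_extra: "card extra + q * (n + 4) = n + card (edges H)"
  unfolding extra(2) q_def by (rule mod_div_mult_eq)

lemma finite_special_extra: "finite special" "finite extra"
  using special(1) extra(1) by (auto intro: finite_subset)

lemma card_free_colors: "card (colors - special) = n"
  using special finite_special_extra by (simp add: card_Diff_subset)

lemma card_adjacent_edges: "e \<in> edges H \<Longrightarrow> card {f \<in> edges H. adjacent_edges e f} \<le> 4"
  using card_adjacent_edges_le[OF simple, of 3] by (simp add: degree_eq)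

text \<open>Every free color is used by exactly one vertex of the copy.\<close>

definition edge_quota :: "nat \<Rightarrow> nat" where
  "edge_quota i = q + of_bool (i \<in> extra) - of_bool (i \<notin> special)"

lemma sum_edge_quota: "sum edge_quota colors = card (edges H)"
proof -
  have "q > 0"
    by (simp add: q_eq)
  then have "(\<Sum>i\<in>colors. edge_quota i + of_bool (i \<notin> special)) = (\<Sum>i\<in>colors. q + of_bool (i \<in> extra))"
    by (intro sum.cong) (auto simp: edge_quota_def)
  moreover have "(\<Sum>i\<in>colors. of_bool (i \<notin> special)) = n"
    using card_free_colors by (simp add: of_bool_def sum.If_cases Diff_eq Compl_eq)
  moreover have "(\<Sum>i\<in>colors. of_bool (i \<in> extra)) = card extra"
    using extra(1) by (simp add: of_bool_def sum.If_cases Int_absorb1)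
  ultimately show ?thesis
    using card_extra by (simp add: sum.distrib algebra_simps)
qed

definition quota_coloring :: "('b set \<Rightarrow> nat) \<Rightarrow> bool" where
  "quota_coloring b \<longleftrightarrow> proper_coloring adjacent_edges (edges H) colors b \<and>
    (\<forall>i\<in>colors. class_size (edges H) b i = edge_quota i)"

definition free_colors_seen :: "('b set \<Rightarrow> nat) \<Rightarrow> 'b \<Rightarrow> nat set" where
  "free_colors_seen b x = b ` incident_edges H x - special"

lemma card_free_colors_seen_le:
  "card (free_colors_seen b x) \<le> card {e \<in> incident_edges H x. b e \<notin> special}"
proof -
  have "free_colors_seen b x = b ` {e \<in> incident_edges H x. b e \<notin> special}"
    by (auto simp: free_colors_seen_def)
  then show ?thesis
    using finite_edges[OF simple] by (simp add: card_image_le)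
qed

lemma exists_quota_coloring_large:
  assumes "8 \<le> n"
  shows "\<exists>b. quota_coloring b"
proof -
  have "\<exists>b. proper_coloring adjacent_edges (edges H) colors b \<and>
    (\<forall>i\<in>colors. class_size (edges H) b i = edge_quota i)"
  proof (rule proper_coloring_with_class_sizes[where d = 4])
    fix i K assume K_le: "K \<subseteq> colors" "card K \<le> 4"
    have quota_le: "edge_quota i \<le> q + 1" for i
      by (auto simp: edge_quota_def)
    have "sum edge_quota K \<le> card K * (q + 1)"
      using sum_bounded_above[of K edge_quota "q + 1"] quota_le by simp
    also have "\<dots> \<le> 4 * (q + 1)"
      using K_le(2) by (rule mult_le_mono1)
    finally have "sum edge_quota K + 4 * (edge_quota i - 1) \<le> 4 * (q + 1) + 4 * q"
      using quota_le[of i] by linarith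
    also have "\<dots> \<le> card (edges H)"
      using card_edges assms by (simp add: q_eq)
    also have "\<dots> = sum edge_quota (colors - K) + sum edge_quota K"
      using sum.subset_diff[OF K_le(1), of edge_quota] sum_edge_quota by simp
    finally show "4 * (edge_quota i - 1) \<le> sum edge_quota (colors - K)"
      by simp
  qed (use finite_edges[OF simple] sum_edge_quota card_adjacent_edges symp_adjacent_edges
      irreflp_on_adjacent_edges in auto)
  then show ?thesis
    by (simp add: quota_coloring_def)
qed

lemma card_special_minus_extra:
  assumes "n < 16" and pairs: "matching disjnt (edges H) P" "card P = card (extra \<inter> special)"
    and singletons: "T \<subseteq> edges H - \<Union>P" "card T = card (extra - special)"
  shows "card (edges H - \<Union>P - T) = card (special - extra)"
proof -
  have finite_E: "finite (edges H)"
    by (rule finite_edges[OF simple])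
  have "\<Union>P \<subseteq> edges H"
    using pairs(1) by (auto simp: matching_def)
  then have "card (edges H - \<Union>P - T) = card (edges H) - 2 * card P - card T"
    using finite_E singletons(1) card_Union_matching[OF pairs(1)]
    by (simp add: card_Diff_subset finite_subset)
  moreover have "card extra = card (extra \<inter> special) + card (extra - special)"
    "card special = card (extra \<inter> special) + card (special - extra)"
    using card_Int_Diff[OF finite_special_extra(2), of special]
      card_Int_Diff[OF finite_special_extra(1), of extra] by (simp_all add: Int_commute)
  moreover have "card (edges H) = card extra + 4"
    using card_extra \<open>n < 16\<close> by (simp add: q_eq)
  ultimately show ?thesis
    using pairs(2) singletons(2) special(2) by simp
qed

lemma exists_quota_coloring_of_pairs:
  assumes "n < 16" and pairs: "matching disjnt (edges H) P" "card P = card (extra \<inter> special)"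
    and singletons: "T \<subseteq> edges H - \<Union>P" "card T = card (extra - special)"
  shows "\<exists>b. quota_coloring b \<and> (\<forall>e\<in>edges H. b e \<notin> special \<longrightarrow> e \<in> T)"
proof -
  let ?both = "extra \<inter> special" and ?one = "(extra - special) \<union> (special - extra)"
  note finite_E = finite_edges[OF simple]
  have "card ?one = card (extra - special) + card (special - extra)"
    using finite_special_extra by (intro card_Un_disjoint) auto
  also have "\<dots> = card T + card (edges H - \<Union>P - T)"
    using singletons(2) card_special_minus_extra[OF assms] by simp
  also have "\<dots> = card (edges H - \<Union>P)"
    using finite_E singletons(1) by (simp add: card_Diff_subset card_mono finite_subset)
  finally have card_one: "card ?one = card (edges H - \<Union>P)" .
  have "\<exists>b. proper_coloring adjacent_edges (edges H) (?both \<union> ?one) b \<and>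
    (\<forall>i. class_size (edges H) b i = 2 * of_bool (i \<in> ?both) + of_bool (i \<in> ?one)) \<and>
    (\<forall>e\<in>edges H. b e \<in> extra - special \<longrightarrow> e \<in> T)"
    by (rule exists_coloring_with_pairs_and_singletons[OF finite_E _ _ _ _ pairs(1) _
          pairs(2)[symmetric] card_one])
      (use finite_special_extra singletons irreflp_on_adjacent_edges in \<open>auto simp: disjnt_def\<close>)
  then obtain b where coloring: "proper_coloring adjacent_edges (edges H) (?both \<union> ?one) b"
    and size: "\<forall>i. class_size (edges H) b i = 2 * of_bool (i \<in> ?both) + of_bool (i \<in> ?one)"
    and free_in_T: "\<forall>e\<in>edges H. b e \<in> extra - special \<longrightarrow> e \<in> T"
    by blast
  have "proper_coloring adjacent_edges (edges H) colors b"
    using coloring special(1) extra(1) unfolding list_coloring_def by blast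
  moreover have "class_size (edges H) b i = edge_quota i" for i
    using size \<open>n < 16\<close> by (simp add: edge_quota_def q_eq)
  moreover have "e \<in> T" if "e \<in> edges H" "b e \<notin> special" for e
    using coloring free_in_T that unfolding list_coloring_def by blast
  ultimately show ?thesis
    unfolding quota_coloring_def by blast
qed

lemma card_vertices_seeing_free_color:
  assumes "quota_coloring b" and i_free: "i \<in> colors - special"
  shows "card {x \<in> verts H. i \<in> free_colors_seen b x} \<le> 2 * q"
proof -
  let ?E = "{e \<in> edges H. b e = i}"
  have "{x \<in> verts H. i \<in> free_colors_seen b x} = (\<Union>e\<in>?E. e)"
    using i_free edge_subset_verts[OF simple] by (auto simp: free_colors_seen_def)
  also have "card \<dots> \<le> (\<Sum>e\<in>?E. card e)"
    using finite_edges[OF simple] by (intro card_UN_le) simp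
  also have "\<dots> = 2 * edge_quota i"
    using assms card_edge[OF simple] by (simp add: quota_coloring_def)
  also have "\<dots> \<le> 2 * q"
    using i_free by (simp add: edge_quota_def)
  finally show ?thesis .
qed

lemma free_colors_seen_subset:
  assumes "quota_coloring b"
  shows "free_colors_seen b x \<subseteq> colors - special"
  using assms by (auto simp: quota_coloring_def list_coloring_def free_colors_seen_def)

lemma exists_vertex_coloring:
  assumes quota: "quota_coloring b"
    and few_seen: "\<And>x. x \<in> verts H \<Longrightarrow> card (free_colors_seen b x) \<le> d" "d + 2 * q \<le> n"
  shows "\<exists>a. bij_betw a (verts H) (colors - special) \<and> (\<forall>x\<in>verts H. a x \<notin> free_colors_seen b x)"
proof (rule bij_betw_avoiding)
  fix x i assume "x \<in> verts H" "i \<in> free_colors_seen b x"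
  then show "card (free_colors_seen b x) + card {z \<in> verts H. i \<in> free_colors_seen b z}
      \<le> card (verts H)"
    using few_seen card_vertices_seeing_free_color[OF quota, of i] free_colors_seen_subset[OF quota, of x]
    by fastforce
qed (use finite_verts[OF simple] card_free_colors free_colors_seen_subset[OF quota] in auto)

lemma exists_join_coloring:
  assumes quota: "quota_coloring b"
    and few_seen: "\<And>x. x \<in> verts H \<Longrightarrow> card (free_colors_seen b x) \<le> d" "d + 2 * q + 2 \<le> n"
    and bij_a: "bij_betw a (verts H) (colors - special)"
  shows "\<exists>l. bij_betw l (verts H) (colors - special) \<and>
    (\<forall>x\<in>verts H. l x \<notin> insert (a x) (free_colors_seen b x))"
proof (rule bij_betw_avoiding)
  have subset: "insert (a x) (free_colors_seen b x) \<subseteq> colors - special" if "x \<in> verts H" for x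
    using bij_betwE[OF bij_a] free_colors_seen_subset[OF quota] that by blast
  then show "\<And>x. x \<in> verts H \<Longrightarrow> insert (a x) (free_colors_seen b x) \<subseteq> colors - special" .
  fix x i assume x_in: "x \<in> verts H" and i_avoided: "i \<in> insert (a x) (free_colors_seen b x)"
  have "card (insert (a x) (free_colors_seen b x)) \<le> d + 1"
    using few_seen(1)[OF x_in] card_insert_le_m1[of "d + 1" "free_colors_seen b x" "a x"] by simp
  moreover have "card {z \<in> verts H. i \<in> insert (a z) (free_colors_seen b z)} \<le> 2 * q + 1"
  proof -
    let ?A = "{z \<in> verts H. a z = i}" and ?B = "{z \<in> verts H. i \<in> free_colors_seen b z}"
    have "i \<in> colors - special"
      using subset[OF x_in] i_avoided by blast
    then have "card ?A + card ?B \<le> 2 * q + 1"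
      using card_vertices_seeing_free_color[OF quota, of i]
      by (simp add: class_size_bij_betw[OF bij_a])
    moreover have "{z \<in> verts H. i \<in> insert (a z) (free_colors_seen b z)} = ?A \<union> ?B"
      by auto
    ultimately show ?thesis
      using card_Un_le[of ?A ?B] by simp
  qed
  ultimately show "card (insert (a x) (free_colors_seen b x)) +
      card {z \<in> verts H. i \<in> insert (a z) (free_colors_seen b z)} \<le> card (verts H)"
    using few_seen(2) by linarith
qed (use finite_verts[OF simple] card_free_colors in auto)

definition copy_coloring :: "('b + 'b set \<Rightarrow> nat) \<Rightarrow> ('b \<Rightarrow> nat) \<Rightarrow> bool" where
  "copy_coloring c l \<longleftrightarrow> total_coloring H (n + 4) c \<and> (\<forall>x\<in>verts H. c (Inl x) \<notin> special) \<and>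
    bij_betw l (verts H) (colors - special) \<and> (\<forall>x\<in>verts H. l x \<notin> colors_at H c x) \<and>
    (\<forall>i\<in>colors. card (color_class H c i) = q + of_bool (i \<in> extra))"

lemma copy_coloring_case_sum:
  assumes quota: "quota_coloring b"
    and a_props: "bij_betw a (verts H) (colors - special)"
      "\<And>x. x \<in> verts H \<Longrightarrow> a x \<notin> free_colors_seen b x"
    and l_props: "bij_betw l (verts H) (colors - special)"
      "\<And>x. x \<in> verts H \<Longrightarrow> l x \<notin> insert (a x) (free_colors_seen b x)"
  shows "copy_coloring (case_sum a b) l"
proof -
  have free: "a x \<in> colors - special" "l x \<in> colors - special" if "x \<in> verts H" for x
    using that bij_betwE[OF a_props(1)] bij_betwE[OF l_props(1)] by auto
  have "total_coloring H (n + 4) (case_sum a b)"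
  proof (rule total_coloring_case_sum[OF simple])
    have "a x \<noteq> a y" if "x \<in> verts H" "y \<in> verts H" "{x, y} \<in> edges H" for x y
      using edge_doubletonD(3)[OF simple that(3)] that(1,2) bij_betw_imp_inj_on[OF a_props(1)]
      by (metis inj_onD)
    then show "proper_coloring (\<lambda>x y. {x, y} \<in> edges H) (verts H) colors a"
      using free(1) by (auto simp: list_coloring_def)
    show "a x \<noteq> b e" if "e \<in> edges H" "x \<in> e" for e x
    proof -
      have "x \<in> verts H"
        using edge_subset_verts[OF simple that(1)] that(2) by blast
      then show ?thesis
        using a_props(2)[of x] free(1)[of x] that by (auto simp: free_colors_seen_def)
    qed
  qed (use quota in \<open>simp add: quota_coloring_def\<close>)
  moreover have "l x \<notin> colors_at H (case_sum a b) x" if "x \<in> verts H" for x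
    using l_props(2)[OF that] free(2)[OF that] by (auto simp: colors_at_def free_colors_seen_def)
  moreover have "card (color_class H (case_sum a b) i) = q + of_bool (i \<in> extra)"
    if "i \<in> colors" for i
    using quota that
    by (simp add: card_color_class[OF simple] class_size_bij_betw[OF a_props(1)] quota_coloring_def
        edge_quota_def q_eq)
  ultimately show ?thesis
    using free(1) l_props(1) by (simp add: copy_coloring_def)
qed

lemma exists_copy_coloring_if_few_free_colors_seen:
  assumes quota: "quota_coloring b"
    and few_seen: "\<And>x. x \<in> verts H \<Longrightarrow> card (free_colors_seen b x) \<le> d" "d + 2 * q + 2 \<le> n"
  shows "\<exists>c l. copy_coloring c l"
proof -
  have "d + 2 * q \<le> n"
    using few_seen(2) by simp
  then obtain a where a_props: "bij_betw a (verts H) (colors - special)"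
    "\<forall>x\<in>verts H. a x \<notin> free_colors_seen b x"
    using exists_vertex_coloring[OF quota few_seen(1)] by blast
  moreover obtain l where "bij_betw l (verts H) (colors - special)"
    "\<forall>x\<in>verts H. l x \<notin> insert (a x) (free_colors_seen b x)"
    using exists_join_coloring[OF quota few_seen a_props(1)] by blast
  ultimately show ?thesis
    using copy_coloring_case_sum[OF quota] by blast
qed

lemma exists_copy_coloring_large:
  assumes "8 \<le> n"
  shows "\<exists>c l. copy_coloring c l"
proof -
  obtain b where "quota_coloring b"
    using exists_quota_coloring_large[OF assms] by blast
  then show ?thesis
  proof (rule exists_copy_coloring_if_few_free_colors_seen)
    fix x assume x_in: "x \<in> verts H"
    have "card {e \<in> incident_edges H x. b e \<notin> special} \<le> degree H x"
      unfolding degree_def using finite_edges[OF simple] by (intro card_mono) auto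
    then show "card (free_colors_seen b x) \<le> 3"
      using card_free_colors_seen_le[of b x] degree_eq[OF x_in] by simp
  qed (use assms in \<open>simp add: q_eq\<close>)
qed

lemma card_disjoint_edges_ge:
  assumes "e \<in> edges H"
  shows "card (edges H) \<le> card {f \<in> edges H. disjnt e f} + 5"
proof -
  let ?D = "{f \<in> edges H. disjnt e f}" and ?A = "{f \<in> edges H. adjacent_edges e f}"
  have finite_E: "finite (edges H)"
    by (rule finite_edges[OF simple])
  have "card (edges H) \<le> card (?D \<union> insert e ?A)"
    using finite_E by (intro card_mono) (auto simp: disjnt_def)
  also have "\<dots> \<le> card ?D + card (insert e ?A)"
    by (rule card_Un_le)
  also have "card (insert e ?A) \<le> 5"
    using card_adjacent_edges[OF assms] finite_E by (simp add: card_insert_if)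
  finally show ?thesis by simp
qed

lemma exists_four_disjoint_pairs:
  assumes "n = 6"
  shows "\<exists>P. matching disjnt (edges H) P \<and> card P = 4"
proof (rule exists_matching_of_min_degree)
  show "symp (disjnt :: 'b set \<Rightarrow> 'b set \<Rightarrow> bool)"
    by (simp add: symp_def disjnt_sym)
  show "irreflp_on (edges H) disjnt"
    using edge_nonempty[OF simple] by (auto simp: irreflp_on_def disjnt_def)
  show "4 \<le> card {f \<in> edges H. disjnt e f}" if "e \<in> edges H" for e
    using card_disjoint_edges_ge[OF that] card_edges assms by simp
qed (use finite_edges[OF simple] card_edges assms in auto)

lemma exists_pairs_containing:
  assumes "n = 6" and "s \<le> 4"
  shows "\<exists>e f P. e \<in> edges H \<and> f \<in> edges H \<and> disjnt e f \<and>
    matching disjnt (edges H) P \<and> card P = s \<and> (P \<noteq> {} \<longrightarrow> {e, f} \<in> P)"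
proof -
  obtain Q where four_pairs: "matching disjnt (edges H) Q" "card Q = 4"
    using exists_four_disjoint_pairs[OF assms(1)] by blast
  then obtain p where "p \<in> Q"
    by fastforce
  then have p_pair: "p \<subseteq> edges H" "card p = 2" "\<forall>x\<in>p. \<forall>y\<in>p. x \<noteq> y \<longrightarrow> disjnt x y"
    using four_pairs(1) by (auto simp: matching_def)
  obtain e f where p_eq: "p = {e, f}" "e \<noteq> f"
    using p_pair(2) by (meson card_2_iff)
  then have "e \<in> edges H" "f \<in> edges H" "disjnt e f"
    using p_pair(1,3) by simp_all
  moreover obtain P where "matching disjnt (edges H) P" "card P = s" "P \<noteq> {} \<longrightarrow> p \<in> P"
    using exists_submatching_containing[OF four_pairs(1) \<open>p \<in> Q\<close>, of s] assms(2) four_pairs(2) by auto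
  ultimately show ?thesis
    using p_eq(1) by blast
qed

lemma exists_two_edges_completing_cover:
  assumes "n = 6" and ef_disjoint: "e \<in> edges H" "f \<in> edges H" "disjnt e f"
  shows "\<exists>K\<subseteq>edges H. card K \<le> 2 \<and> verts H \<subseteq> e \<union> f \<union> \<Union>K"
proof -
  have finite_ef: "finite e" "finite f"
    using finite_verts[OF simple] edge_subset_verts[OF simple] ef_disjoint
    by (auto intro: finite_subset)
  then have "card (e \<union> f) = 4"
    using ef_disjoint card_edge[OF simple] by (simp add: card_Un_disjnt)
  moreover have "e \<union> f \<subseteq> verts H"
    using edge_subset_verts[OF simple] ef_disjoint by blast
  ultimately have "card (verts H - (e \<union> f)) = 2"
    using assms(1) finite_ef by (simp add: card_Diff_subset)
  then obtain u w where uncovered: "verts H - (e \<union> f) = {u, w}"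
    by (auto simp: card_2_iff)
  have "\<exists>k\<in>edges H. x \<in> k" if "x \<in> verts H" for x
  proof -
    have "card (incident_edges H x) \<noteq> 0"
      using degree_eq[OF that] by (simp add: degree_def)
    then have "incident_edges H x \<noteq> {}"
      by (metis card.empty)
    then show ?thesis by blast
  qed
  moreover have "u \<in> verts H" "w \<in> verts H"
    using uncovered by auto
  ultimately obtain k k' where k_covers: "k \<in> edges H" "u \<in> k" "k' \<in> edges H" "w \<in> k'"
    by blast
  have "verts H \<subseteq> e \<union> f \<union> {u, w}"
    using uncovered by blast
  then have "verts H \<subseteq> e \<union> f \<union> \<Union>{k, k'}"
    using k_covers by auto
  moreover have "card {k, k'} \<le> 2"
    by (simp add: card_insert_if)
  moreover have "{k, k'} \<subseteq> edges H"
    using k_covers by simp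
  ultimately show ?thesis
    by blast
qed

lemma exists_low_degree_edges_avoiding_pairs:
  assumes "n = 6" and ef_disjoint: "e \<in> edges H" "f \<in> edges H" "disjnt e f"
    and pairs: "matching disjnt (edges H) P" "P \<noteq> {} \<Longrightarrow> {e, f} \<in> P" "card P \<le> 2"
  shows "\<exists>T\<subseteq>edges H - \<Union>P. card T = 5 - card P \<and>
    (\<forall>x\<in>verts H. card (incident_edges H x \<inter> T) \<le> 2)"
proof -
  note finite_E = finite_edges[OF simple]
  obtain K where K_covers: "K \<subseteq> edges H" "card K \<le> 2" "verts H \<subseteq> e \<union> f \<union> \<Union>K"
    using exists_two_edges_completing_cover[OF assms(1) ef_disjoint] by blast
  let ?A = "\<Union>P \<union> {e, f} \<union> K"
  have "card (\<Union>P \<union> {e, f}) \<le> 2 + card P"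
  proof (cases "P = {}")
    case False
    then have "\<Union>P \<union> {e, f} = \<Union>P"
      using pairs(2) by blast
    then show ?thesis
      using card_Union_matching[OF pairs(1)] pairs(3) by simp
  qed (simp add: card_insert_if)
  then have "card ?A \<le> 4 + card P"
    using card_Un_le[of "\<Union>P \<union> {e, f}" K] K_covers(2) by linarith
  moreover have "?A \<subseteq> edges H"
    using pairs(1) K_covers(1) ef_disjoint(1,2) by (auto simp: matching_def)
  then have "card (edges H - ?A) = card (edges H) - card ?A"
    using finite_E by (intro card_Diff_subset) (auto intro: finite_subset)
  ultimately have "5 - card P \<le> card (edges H - ?A)"
    using card_edges assms(1) by linarith
  then obtain T where T_subset: "T \<subseteq> edges H - ?A" "card T = 5 - card P"
    by (meson obtain_subset_with_card_n)
  have "card (incident_edges H x \<inter> T) \<le> 2" if x_in: "x \<in> verts H" for x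
  proof -
    obtain k where "k \<in> {e, f} \<union> K" "x \<in> k"
      using K_covers(3) x_in by blast
    then have "k \<in> incident_edges H x" "k \<notin> T"
      using K_covers(1) ef_disjoint(1,2) T_subset(1) by auto
    have "card (incident_edges H x \<inter> T) \<le> card (incident_edges H x - {k})"
      using finite_E \<open>k \<notin> T\<close> by (intro card_mono) auto
    also have "\<dots> = 2"
      using degree_eq[OF x_in] \<open>k \<in> incident_edges H x\<close> by (simp add: degree_def)
    finally show ?thesis .
  qed
  moreover have "T \<subseteq> edges H - \<Union>P"
    using T_subset(1) by auto
  ultimately show ?thesis
    using T_subset(2) by (intro exI[of _ T]) simp
qed

text \<open>The pairs are meant for special and the edges in \<open>T\<close> for free colors. With at most two pairs, an
  edge at every vertex can be kept out of \<open>T\<close>; otherwise \<open>T\<close> has at most two edges.\<close>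

lemma exists_pairs_and_low_degree_edges:
  assumes "n = 6" and s_le: "s \<le> 4"
  shows "\<exists>P T. matching disjnt (edges H) P \<and> card P = s \<and> T \<subseteq> edges H - \<Union>P \<and> card T = 5 - s \<and>
    (\<forall>x\<in>verts H. card (incident_edges H x \<inter> T) \<le> 2)"
proof -
  note finite_E = finite_edges[OF simple]
  obtain e f P where disjoint_edges: "e \<in> edges H" "f \<in> edges H" "disjnt e f"
    and pairs: "matching disjnt (edges H) P" "card P = s" "P \<noteq> {} \<longrightarrow> {e, f} \<in> P"
    using exists_pairs_containing[OF assms] by (elim exE conjE)
  show ?thesis
  proof (cases "s \<le> 2")
    case True
    then show ?thesis
      using exists_low_degree_edges_avoiding_pairs[OF assms(1) disjoint_edges pairs(1)] pairs by blast
  next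
    case False
    have "\<Union>P \<subseteq> edges H"
      using pairs(1) by (auto simp: matching_def)
    then have "card (edges H - \<Union>P) = 9 - 2 * s"
      using finite_E card_edges assms(1) card_Union_matching[OF pairs(1)] pairs(2)
      by (simp add: card_Diff_subset finite_subset)
    then have "5 - s \<le> card (edges H - \<Union>P)"
      using s_le by simp
    then obtain T where T_subset: "T \<subseteq> edges H - \<Union>P" "card T = 5 - s"
      by (meson obtain_subset_with_card_n)
    then have "finite T"
      using finite_E by (auto intro: finite_subset)
    then have "card (incident_edges H x \<inter> T) \<le> card T" for x
      by (simp add: card_mono)
    also have "card T \<le> 2"
      using T_subset(2) False by simp
    finally show ?thesis
      using pairs T_subset by blast
  qed
qed

lemma exists_copy_coloring_6:
  assumes "n = 6"
  shows "\<exists>c l. copy_coloring c l"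
proof -
  have "card extra = 5"
    using extra(2) card_edges assms by simp
  moreover have "card extra = card (extra \<inter> special) + card (extra - special)"
    using card_Int_Diff[OF finite_special_extra(2)] .
  moreover have "card (extra \<inter> special) \<le> 4"
    using card_mono[of special "extra \<inter> special"] finite_special_extra(1) special(2) by simp
  ultimately obtain P T where pairs: "matching disjnt (edges H) P" "card P = card (extra \<inter> special)"
    and singletons: "T \<subseteq> edges H - \<Union>P" "card T = card (extra - special)"
    and few: "\<forall>x\<in>verts H. card (incident_edges H x \<inter> T) \<le> 2"
    using exists_pairs_and_low_degree_edges[OF assms, of "card (extra \<inter> special)"] by auto
  obtain b where quota: "quota_coloring b" "\<forall>e\<in>edges H. b e \<notin> special \<longrightarrow> e \<in> T"
    using exists_quota_coloring_of_pairs[OF _ pairs singletons] assms by auto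
  show ?thesis
  proof (rule exists_copy_coloring_if_few_free_colors_seen[OF quota(1)])
    fix x assume "x \<in> verts H"
    have "card {e \<in> incident_edges H x. b e \<notin> special} \<le> card (incident_edges H x \<inter> T)"
      using quota(2) finite_edges[OF simple] by (intro card_mono) auto
    then show "card (free_colors_seen b x) \<le> 2"
      using few \<open>x \<in> verts H\<close> card_free_colors_seen_le[of b x] by fastforce
  qed (use assms in \<open>simp add: q_eq\<close>)
qed

lemma edges_complete:
  assumes "n = 4"
  shows "edges H = {e. e \<subseteq> verts H \<and> card e = 2}"
proof (rule card_subset_eq)
  show "finite {e. e \<subseteq> verts H \<and> card e = 2}"
    using finite_verts[OF simple] by simp
  show "edges H \<subseteq> {e. e \<subseteq> verts H \<and> card e = 2}"
    using edge_subset_verts[OF simple] card_edge[OF simple] by blast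
  show "card (edges H) = card {e. e \<subseteq> verts H \<and> card e = 2}"
    using n_subsets[OF finite_verts[OF simple], of 2] assms card_edges by (simp add: choose_two)
qed

lemma complementary_edge:
  assumes "n = 4" and e_in: "e \<in> edges H"
  shows "verts H - e \<in> edges H" and "verts H - e \<noteq> e"
proof -
  show "verts H - e \<in> edges H"
    using finite_verts[OF simple] e_in assms(1) unfolding edges_complete[OF assms(1)]
    by (auto simp: card_Diff_subset finite_subset)
  show "verts H - e \<noteq> e"
    using edge_subset_verts[OF simple e_in] edge_nonempty[OF simple e_in] by blast
qed

lemma exists_two_complementary_pairs:
  assumes "n = 4"
  shows "\<exists>e f. e \<in> edges H \<and> e \<notin> {f, verts H - f} \<and>
    matching disjnt (edges H) {{e, verts H - e}, {f, verts H - f}}"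
proof -
  have six: "card (edges H) = 6"
    using card_edges assms by simp
  then obtain e where e_in: "e \<in> edges H"
    by fastforce
  have "card {e, verts H - e} \<le> 2"
    by (simp add: card_insert_if)
  then have "\<not> edges H \<subseteq> {e, verts H - e}"
    using six card_mono[of "{e, verts H - e}" "edges H"] by auto
  then obtain f where f_new: "f \<in> edges H" "f \<noteq> e" "f \<noteq> verts H - e"
    by blast
  let ?p = "{e, verts H - e}" and ?q = "{f, verts H - f}"
  note complement = complementary_edge[OF assms e_in] complementary_edge[OF assms f_new(1)]
  have disjoint: "?p \<inter> ?q = {}"
    using e_in f_new edge_subset_verts[OF simple] by auto
  moreover have "card ?p = 2" "card ?q = 2"
    using complement(2,4) by auto
  ultimately have "matching disjnt (edges H) {?p, ?q}"
    using complement(1,3) e_in f_new(1) by (auto simp: matching_def pairwise_insert disjnt_def)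
  moreover have "e \<notin> ?q"
    using disjoint by blast
  ultimately show ?thesis
    using e_in by (intro exI[of _ e] exI[of _ f] conjI)
qed

lemma exists_quota_coloring_4:
  assumes "n = 4"
  shows "\<exists>b e. quota_coloring b \<and> e \<in> edges H \<and>
    (\<forall>f\<in>edges H. b f \<notin> special \<longrightarrow> f = e \<or> f = verts H - e)"
proof -
  obtain e f where e_in: "e \<in> edges H" and e_new: "e \<notin> {f, verts H - f}"
    and matching: "matching disjnt (edges H) {{e, verts H - e}, {f, verts H - f}}"
    using exists_two_complementary_pairs[OF assms] by blast
  let ?p = "{e, verts H - e}" and ?q = "{f, verts H - f}"
  have "card extra = 2"
    using extra(2) card_edges assms by simp
  then consider (two_free) "card (extra \<inter> special) = 0" "card (extra - special) = 2"
    | (one_free) "card (extra \<inter> special) = 1" "card (extra - special) = 1"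
    | (none_free) "card (extra \<inter> special) = 2" "card (extra - special) = 0"
    using card_Int_Diff[OF finite_special_extra(2), of special] by linarith
  then obtain P T where pairs: "P \<subseteq> {?p, ?q}" "card P = card (extra \<inter> special)"
    and singletons: "T \<subseteq> ?p - \<Union>P" "card T = card (extra - special)"
  proof cases
    case two_free
    then show thesis
      using that[of "{}" ?p] complementary_edge(2)[OF assms e_in] by auto
  next
    case one_free
    then show thesis
      using that[of "{?q}" "{e}"] e_new by simp
  next
    case none_free
    have "?p \<noteq> ?q"
      using e_new by blast
    then have "card {?p, ?q} = 2"
      by simp
    with none_free show thesis
      using that[of "{?p, ?q}" "{}"] by simp
  qed
  moreover have "T \<subseteq> edges H - \<Union>P"
    using singletons(1) e_in complementary_edge(1)[OF assms e_in] by auto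
  ultimately obtain b where "quota_coloring b" "\<forall>e\<in>edges H. b e \<notin> special \<longrightarrow> e \<in> T"
    using exists_quota_coloring_of_pairs[OF _ matching_subset[OF matching pairs(1)] pairs(2) _
        singletons(2)]
      assms by auto
  then show ?thesis
    using e_in singletons(1) by blast
qed

text \<open>Exchanging the endpoints of \<open>e\<close> and those of its complement turns the vertex coloring into a
  coloring of the joining edges.\<close>

lemma exists_join_coloring_4:
  assumes "n = 4" and e_free: "e \<in> edges H" "\<forall>f\<in>edges H. b f \<notin> special \<longrightarrow> f = e \<or> f = verts H - e"
    and a_props: "bij_betw a (verts H) (colors - special)" "\<forall>x\<in>verts H. a x \<notin> free_colors_seen b x"
  shows "\<exists>l. bij_betw l (verts H) (colors - special) \<and>
    (\<forall>x\<in>verts H. l x \<notin> insert (a x) (free_colors_seen b x))"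
proof -
  obtain u w where e_eq: "e = {u, w}" "u \<noteq> w"
    using card_edge[OF simple e_free(1)] by (auto simp: card_2_iff)
  obtain y z where complement_eq: "verts H - e = {y, z}" "y \<noteq> z"
    using card_edge[OF simple complementary_edge(1)[OF assms(1) e_free(1)]] by (auto simp: card_2_iff)
  have verts_eq: "verts H = {u, w, y, z}"
    using e_eq(1) complement_eq(1) edge_subset_verts[OF simple e_free(1)] by blast
  have distinct: "u \<notin> {y, z}" "w \<notin> {y, z}"
    using e_eq(1) complement_eq(1) by blast+
  let ?\<sigma> = "transpose u w \<circ> transpose y z"
  have partner: "?\<sigma> x \<in> verts H" "?\<sigma> x \<noteq> x" "?\<sigma> x \<in> e \<longleftrightarrow> x \<in> e" if "x \<in> verts H" for x
    using that e_eq complement_eq(2) distinct unfolding verts_eq by (auto simp: transpose_def)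
  have inj: "inj_on ?\<sigma> (verts H)"
    by (intro comp_inj_on inj_on_transpose)
  have "?\<sigma> ` verts H = verts H"
    using partner(1) by (intro endo_inj_surj[OF finite_verts[OF simple] _ inj] image_subsetI)
  then have "bij_betw ?\<sigma> (verts H) (verts H)"
    using inj by (simp only: bij_betw_def)
  then have "bij_betw (a \<circ> ?\<sigma>) (verts H) (colors - special)"
    using a_props(1) by (rule bij_betw_trans)
  moreover have "(a \<circ> ?\<sigma>) x \<notin> insert (a x) (free_colors_seen b x)" if x_in: "x \<in> verts H" for x
  proof -
    have "a (?\<sigma> x) \<noteq> a x"
      using partner[OF x_in] x_in bij_betw_imp_inj_on[OF a_props(1)] by (metis inj_onD)
    moreover have "f \<in> incident_edges H (?\<sigma> x)" if "f \<in> incident_edges H x" "b f \<notin> special" for f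
      using that e_free(2) partner[OF x_in] by auto
    then have "free_colors_seen b x \<subseteq> free_colors_seen b (?\<sigma> x)"
      by (auto simp: free_colors_seen_def)
    then have "a (?\<sigma> x) \<notin> free_colors_seen b x"
      using a_props(2) partner(1)[OF x_in] by blast
    ultimately show ?thesis by simp
  qed
  ultimately show ?thesis by blast
qed

lemma exists_copy_coloring_4:
  assumes "n = 4"
  shows "\<exists>c l. copy_coloring c l"
proof -
  obtain b e where quota: "quota_coloring b"
    and e_free: "e \<in> edges H" "\<forall>f\<in>edges H. b f \<notin> special \<longrightarrow> f = e \<or> f = verts H - e"
    using exists_quota_coloring_4[OF assms] by blast
  have "card (free_colors_seen b x) \<le> 1" if "x \<in> verts H" for x
  proof -
    have "{f \<in> incident_edges H x. b f \<notin> special} \<subseteq> {if x \<in> e then e else verts H - e}"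
      using e_free(2) by auto
    from card_mono[OF _ this] have "card {f \<in> incident_edges H x. b f \<notin> special} \<le> 1"
      by simp
    then show ?thesis
      using card_free_colors_seen_le[of b x] by simp
  qed
  then obtain a where a_props: "bij_betw a (verts H) (colors - special)"
    "\<forall>x\<in>verts H. a x \<notin> free_colors_seen b x"
    using exists_vertex_coloring[OF quota, of 1] assms by (auto simp: q_eq)
  then obtain l where "bij_betw l (verts H) (colors - special)"
    "\<forall>x\<in>verts H. l x \<notin> insert (a x) (free_colors_seen b x)"
    using exists_join_coloring_4[OF assms e_free] by blast
  then show ?thesis
    using copy_coloring_case_sum[OF quota] a_props by blast
qed

lemma exists_copy_coloring: "\<exists>c l. copy_coloring c l"
  using n_cases exists_copy_coloring_4 exists_copy_coloring_6 exists_copy_coloring_large by blast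

end

section \<open>The corona of two cubic graphs\<close>

lemma max_degree_cubic:
  assumes "cubic_graph G"
  shows "max_degree G = 3"
proof -
  have "degree G ` verts G = {3}"
    using assms by (auto simp: cubic_graph_def simple_graph_def)
  then show ?thesis
    by (simp add: max_degree_def)
qed

lemma max_degree_corona_cubic:
  assumes "cubic_graph G" and "cubic_graph H"
  shows "max_degree (corona G H) = card (verts H) + 3"
  using assms max_degree_corona[of G H] card_verts_cubic_ge[OF assms(2)]
  by (simp add: max_degree_cubic cubic_graph_def)

text \<open>A color of \<open>m\<close> edges of \<open>G\<close> is seen by \<open>m\<close> more vertices of \<open>G\<close> than \<open>G\<close> has elements of this
  color, and the other vertices of \<open>G\<close> have a joining edge of this color.\<close>

lemma card_color_class_corona_add:
  assumes simple_G: "simple_graph G" and simple_H: "simple_graph H"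
    and coloring: "total_coloring G k c" and "i < k"
    and bij_joins: "\<And>v. v \<in> verts G \<Longrightarrow> bij_betw (l v) (verts H) ({..<k} - colors_at G c v)"
    and copy_size: "\<And>v. v \<in> verts G \<Longrightarrow> card (color_class H (d v) i) = q + of_bool (i \<in> S v)"
  shows "card (color_class (corona G H) (corona_coloring G H c d l) i) +
      class_size (edges G) (\<lambda>e. c (Inr e)) i
    = (q + 1) * card (verts G) + card {v \<in> verts G. i \<in> S v}"
proof -
  have finite_V: "finite (verts G)"
    by (rule finite_verts[OF simple_G])
  have sum_of_bool: "(\<Sum>v\<in>verts G. of_bool (Q v)) = card {v \<in> verts G. Q v}" for Q
    using finite_V by (simp add: of_bool_def sum.If_cases Int_def)
  have "(\<Sum>v\<in>verts G. card (color_class H (d v) i) + class_size (verts H) (l v) i) =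
      (\<Sum>v\<in>verts G. q + of_bool (i \<in> S v) + of_bool (i \<notin> colors_at G c v))"
    using copy_size class_size_bij_betw[OF bij_joins] \<open>i < k\<close> by (intro sum.cong) auto
  also have "\<dots> = q * card (verts G) + card {v \<in> verts G. i \<in> S v} +
      card {v \<in> verts G. i \<notin> colors_at G c v}"
    by (simp add: sum.distrib sum_of_bool)
  finally have "card (color_class (corona G H) (corona_coloring G H c d l) i) =
      card (color_class G c i) +
      (q * card (verts G) + card {v \<in> verts G. i \<in> S v} +
        card {v \<in> verts G. i \<notin> colors_at G c v})"
    by (simp add: card_color_class_corona[OF simple_G simple_H])
  moreover have "card (verts G) =
      card {v \<in> verts G. i \<in> colors_at G c v} + card {v \<in> verts G. i \<notin> colors_at G c v}"
    using card_Int_Diff[OF finite_V, of "{v. i \<in> colors_at G c v}"] by (simp add: Int_def set_diff_eq)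
  ultimately show ?thesis
    using card_verts_seeing_color[OF simple_G coloring, of i] by simp
qed

context
  fixes G :: "'a ugraph" and H :: "'b ugraph" and k c S d l
  assumes simple_G: "simple_graph G" and k_eq: "k = card (verts H) + 4"
    and coloring_G: "total_coloring G k c"
    and copy: "\<And>v. v \<in> verts G \<Longrightarrow> cubic_copy H (colors_at G c v) (S v)"
    and copy_coloring: "\<And>v. v \<in> verts G \<Longrightarrow>
      cubic_copy.copy_coloring H (colors_at G c v) (S v) (d v) (l v)"
begin

lemma copy_colorings:
  assumes "v \<in> verts G"
  shows "total_coloring H k (d v)"
    and "\<And>x. x \<in> verts H \<Longrightarrow> d v (Inl x) \<notin> colors_at G c v"
    and "bij_betw (l v) (verts H) ({..<k} - colors_at G c v)"
    and "\<And>x. x \<in> verts H \<Longrightarrow> l v x \<notin> colors_at H (d v) x"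
    and "\<And>i. i < k \<Longrightarrow> card (color_class H (d v) i) = cubic_copy.q H + of_bool (i \<in> S v)"
  using copy_coloring[OF assms]
  unfolding cubic_copy.copy_coloring_def[OF copy[OF assms]] by (auto simp: k_eq)

lemma total_coloring_corona_copies:
  assumes simple_H: "simple_graph H"
  shows "total_coloring (corona G H) k (corona_coloring G H c d l)"
proof (rule total_coloring_corona[OF simple_G simple_H coloring_G])
  show "total_coloring H k (d v)" if "v \<in> verts G" for v
    by (rule copy_colorings(1)[OF that])
  show "c (Inl v) \<noteq> d v (Inl x)" if "v \<in> verts G" "x \<in> verts H" for v x
    using copy_colorings(2)[OF that] by (auto simp: colors_at_def)
  show "inj_on (l v) (verts H)" if "v \<in> verts G" for v
    using copy_colorings(3)[OF that] by (rule bij_betw_imp_inj_on)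
  show "l v x \<in> {..<k} - colors_at G c v - colors_at H (d v) x" if "v \<in> verts G" "x \<in> verts H" for v x
    using bij_betwE[OF copy_colorings(3)] copy_colorings(4) that by blast
qed

lemma equitable_total_coloring_corona_copies:
  assumes simple_H: "simple_graph H"
    and balanced: "balanced_on {..<k} (\<lambda>i. - int (class_size (edges G) (\<lambda>e. c (Inr e)) i) +
      int (card {v \<in> verts G. i \<in> S v}))"
  shows "equitable_total_coloring (corona G H) k (corona_coloring G H c d l)"
proof -
  let ?size = "\<lambda>i. card (color_class (corona G H) (corona_coloring G H c d l) i)"
    and ?m = "class_size (edges G) (\<lambda>e. c (Inr e))"
  have "?size i \<le> ?size j + 1" if "i < k" "j < k" for i j
  proof -
    have size: "?size t + ?m t = (cubic_copy.q H + 1) * card (verts G) + card {v \<in> verts G. t \<in> S v}"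
      if "t < k" for t
      by (rule card_color_class_corona_add[OF simple_G simple_H coloring_G that copy_colorings(3)
            copy_colorings(5)[OF _ that]])
    have "- int (?m i) + int (card {v \<in> verts G. i \<in> S v}) \<le>
        - int (?m j) + int (card {v \<in> verts G. j \<in> S v}) + 1"
      using balanced that by (simp add: balanced_on_def)
    then show ?thesis
      using size[OF that(1)] size[OF that(2)] by linarith
  qed
  then show ?thesis
    using total_coloring_corona_copies[OF simple_H] by (simp add: equitable_total_coloring_def)
qed

end

lemma exists_equitable_total_coloring_corona_cubic:
  assumes cubic_G: "cubic_graph G" and cubic_H: "cubic_graph H"
  shows "\<exists>c. equitable_total_coloring (corona G H) (card (verts H) + 4) c"
proof -
  have simple_G: "simple_graph G" and simple_H: "simple_graph H"
    and degree_eq: "\<And>v. v \<in> verts G \<Longrightarrow> degree G v = 3"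
    using cubic_G cubic_H by (auto simp: cubic_graph_def)
  define k where "k = card (verts H) + 4"
  define r where "r = (card (verts H) + card (edges H)) mod k"
  have "r \<le> card {..<k}"
    by (simp add: r_def k_def less_imp_le)
  obtain c where coloring_G: "total_coloring G k c"
    and "balanced_on {..<k} (class_size (edges G) (\<lambda>e. c (Inr e)))"
    using exists_total_coloring_balanced_edges[OF simple_G, of 3 k] card_verts_cubic_ge[OF cubic_H]
    by (auto simp: degree_eq k_def)
  then obtain S where S_subsets: "\<forall>v\<in>verts G. S v \<subseteq> {..<k} \<and> card (S v) = r"
    and balanced: "balanced_on {..<k} (\<lambda>i. - int (class_size (edges G) (\<lambda>e. c (Inr e)) i) +
      int (card {v \<in> verts G. i \<in> S v}))"
    using exists_balanced_family_of_subsets[OF finite_verts[OF simple_G] _ \<open>r \<le> card {..<k}\<close>]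
      balanced_on_uminus by blast
  have copy: "cubic_copy H (colors_at G c v) (S v)" if "v \<in> verts G" for v
    using cubic_H S_subsets that colors_at_subset[OF coloring_G that]
      card_colors_at[OF simple_G coloring_G that]
    by unfold_locales (auto simp: degree_eq k_def r_def)
  then have "\<forall>v\<in>verts G. \<exists>d l. cubic_copy.copy_coloring H (colors_at G c v) (S v) d l"
    by (blast intro: cubic_copy.exists_copy_coloring)
  then obtain d l where "\<And>v. v \<in> verts G \<Longrightarrow>
      cubic_copy.copy_coloring H (colors_at G c v) (S v) (d v) (l v)"
    by metis
  then have "equitable_total_coloring (corona G H) k (corona_coloring G H c d l)"
    using equitable_total_coloring_corona_copies[OF simple_G k_def coloring_G copy _ simple_H balanced]
    by blast
  then show ?thesis
    unfolding k_def by blast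
qed

theorem theorem7:
  fixes G :: "'a ugraph" and H :: "'b ugraph"
  assumes "cubic_graph G" and "cubic_graph H"
  shows "equitable_total_chromatic_number (corona G H) = max_degree (corona G H) + 1 \<and>
         max_degree (corona G H) + 1 = card (verts H) + 4"
proof -
  have simple: "simple_graph (corona G H)"
    using assms by (simp add: cubic_graph_def simple_graph_corona)
  have max_degree: "max_degree (corona G H) + 1 = card (verts H) + 4"
    using max_degree_corona_cubic[OF assms] by simp
  moreover have "equitable_total_chromatic_number (corona G H) = card (verts H) + 4"
    unfolding equitable_total_chromatic_number_def
  proof (rule Least_equality)
    show "\<exists>c. equitable_total_coloring (corona G H) (card (verts H) + 4) c"
      by (rule exists_equitable_total_coloring_corona_cubic[OF assms])
    show "card (verts H) + 4 \<le> k" if "\<exists>c. equitable_total_coloring (corona G H) k c" for k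
      using that max_degree_less_colors[OF simple] max_degree
      unfolding equitable_total_coloring_def by fastforce
  qed
  ultimately show ?thesis by simp
qed

end
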